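(* Let $\phi\in L^{2}(\mathbb{R})\setminus\{0\}$ and let $f\in L^{2}(\mathbb{R})$ with $V_{\phi}^{A}f\in L^{2}(\mathbb{R}^{2})$. Then $$\left(\int_{\mathbb{R}^{2}}u^{2}\,|V_{\phi}^{A}f(u,w)|^{2}\,dw\,du\right)^{\frac12}\left(\int_{\mathbb{R}}t^{2}|f(t)|^{2}\,dt\right)^{\frac12}\ \geq\ \frac{b}{2}\,\|f\|^{2}\,\|\phi\| .$$
   Context: Let $A=(a,b,c,d,u_{0},w_{0})$ with $a,b,c,d,u_0,w_0\in\mathbb{R}$, $ad-bc=1$ and $b\neq 0$. The offset linear canonical transform kernel is $$K_{A}(t,u)=\frac{1}{\sqrt{i2\pi b}}\,e^{i\frac{a}{2b}t^{2}-i\frac{1}{b}t(u-u_{0})-i\frac{1}{b}u(du_{0}-bw_{0})+i\frac{d}{2b}(u^{2}+u_{0}^{2})}.$$ For a window function $\phi\in L^2(\mathbb{R})\setminus\{0\}$, the windowed offset linear canonical transform (WOLCT) of $f\in L^2(\mathbb{R})$ is $$V^{A}_{\phi}f(u,w)=\int_{\mathbb{R}}f(t)\,\overline{\phi(t-w)}\,K_{A}(t,u)\,dt,\qquad (u,w)\in\mathbb{R}^2 .$$ $\|\cdot\|$ denotes the $L^2(\mathbb{R})$ norm. *)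

theory Defs
  imports "HOL-Analysis.Analysis"
begin

(* Elements of L^2 are represented by functions; "nonzero in L^2" is therefore
   "not almost everywhere zero". *)

definition square_integrable :: "('a::euclidean_space \<Rightarrow> complex) \<Rightarrow> bool" where
  "square_integrable f \<longleftrightarrow>
     f \<in> borel_measurable lebesgue \<and> integrable lebesgue (\<lambda>x. (cmod (f x))\<^sup>2)"

definition L2_norm :: "('a::euclidean_space \<Rightarrow> complex) \<Rightarrow> real" where
  "L2_norm f = sqrt (LINT x|lebesgue. (cmod (f x))\<^sup>2)"

definition ennreal_sqrt :: "ennreal \<Rightarrow> ennreal" where
  "ennreal_sqrt x = (if x = \<infinity> then \<infinity> else ennreal (sqrt (enn2real x)))"

(* The parameter tuple is A = (a, b, c, d, u0, w0). The kernel does not involve c, which is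
   constrained only through a d - b c = 1. The square root of i 2 pi b is the principal one. *)

type_synonym olct_param = "real \<times> real \<times> real \<times> real \<times> real \<times> real"

fun olct_kernel :: "olct_param \<Rightarrow> real \<Rightarrow> real \<Rightarrow> complex" where
  "olct_kernel (a, b, c, d, u0, w0) t u =
     1 / csqrt (\<i> * 2 * of_real pi * of_real b) *
     exp (\<i> * of_real (a / (2 * b) * t\<^sup>2
                     - 1 / b * t * (u - u0)
                     - 1 / b * u * (d * u0 - b * w0)
                     + d / (2 * b) * (u\<^sup>2 + u0\<^sup>2)))"

(* For square-integrable f and \<phi> the integrand below is integrable for every u and w, so the
   integral never takes the default value 0. *)

definition wolct ::
  "olct_param \<Rightarrow> (real \<Rightarrow> complex) \<Rightarrow> (real \<Rightarrow> complex) \<Rightarrow> real \<Rightarrow> real \<Rightarrow> complex" where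
  "wolct A \<phi> f u w = (LINT t|lebesgue. f t * cnj (\<phi> (t - w)) * olct_kernel A t u)"

end

theory Submission
  imports Defs "HOL-Probability.Characteristic_Functions"
begin

text \<open>
  For each window position \<open>w\<close>, the transform \<open>wolct A \<phi> f u w\<close> is, up to a factor of modulus
  \<open>1 / sqrt (2 * pi * \<bar>b\<bar>)\<close>, the Fourier transform at \<open>u / b\<close> of the function
  \<open>g\<^sub>w t = f t * cnj (\<phi> (t - w)) * cis (\<dots>)\<close>, whose last factor is a chirp of modulus \<open>1\<close>
  (\<open>cmod_wolct_power2\<close>). The theorem is therefore Heisenberg's inequality for the functions
  \<open>g\<^sub>w\<close>, integrated over \<open>w\<close>. The moments of \<open>g\<^sub>w\<close> in \<open>t\<close> integrate to those of \<open>f\<close>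
  times the squared norm of \<open>\<phi>\<close> (\<open>nn_integral_windowed\<close>).

  Heisenberg's inequality is used in the weighted form
  \<open>\<parallel>g\<parallel>\<^sup>2 \<le> l / (2 * pi) * \<integral> \<xi>\<^sup>2 * \<bar>G \<xi>\<bar>\<^sup>2 + (1 / l) * \<integral> t\<^sup>2 * \<bar>g t\<bar>\<^sup>2\<close> for all \<open>l > 0\<close>, with \<open>G\<close>
  the Fourier transform of \<open>g\<close> (\<open>heisenberg_weighted\<close>). It can be integrated over \<open>w\<close> term by
  term, and optimising over \<open>l\<close> afterwards replaces the Cauchy-Schwarz inequality in \<open>w\<close>
  (\<open>le_ennreal_sqrt_mult\<close>).

  Its proof replaces the derivative of \<open>g\<close> by difference quotients. Shifting the variable gives
  \<open>\<integral> t * (\<bar>g t\<bar>\<^sup>2 - \<bar>g (t + h)\<bar>\<^sup>2) = h * \<parallel>g\<parallel>\<^sup>2\<close>, and the left-hand side is controlled by the second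
  moment of \<open>g\<close> and by the \<open>L\<^sup>2\<close> norm of \<open>g (t + h) - g t\<close>. The Plancherel inequality
  \<open>2 * pi * \<parallel>g\<parallel>\<^sup>2 \<le> \<parallel>G\<parallel>\<^sup>2\<close> bounds this norm by the second moment of \<open>G\<close>
  (\<open>L2_translation_difference_le\<close>).

  The Plancherel inequality (\<open>plancherel_le\<close>) comes from averaging \<open>\<bar>G\<bar>\<^sup>2\<close> against wide Gaussians:
  the average equals the autocorrelation of \<open>g\<close> integrated against a narrow Gaussian, which tends to
  \<open>\<parallel>g\<parallel>\<^sup>2\<close> because translation is continuous in \<open>L\<^sup>2\<close>
  (\<open>L2_imp_translation_continuous\<close>).
\<close>

section \<open>Continuity of translation in the mean square\<close>

text \<open>
  Formulated along null sequences, so that dominated convergence applies directly. The integral is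
  nonnegative-valued, so no integrability side conditions arise.
\<close>

definition L2_translation_continuous :: "(real \<Rightarrow> complex) \<Rightarrow> bool" where
  "L2_translation_continuous g \<longleftrightarrow>
     (\<forall>h. h \<longlonglongrightarrow> 0 \<longrightarrow>
        (\<lambda>n. \<integral>\<^sup>+t. ennreal ((cmod (g (t + h n) - g t))\<^sup>2) \<partial>lborel) \<longlonglongrightarrow> 0)"

lemma nn_integral_lborel_shift:
  fixes F :: "real \<Rightarrow> ennreal"
  assumes [measurable]: "F \<in> borel_measurable borel"
  shows "(\<integral>\<^sup>+t. F (t + h) \<partial>lborel) = (\<integral>\<^sup>+t. F t \<partial>lborel)"
  using nn_integral_real_affine[of F 1 h] by (simp add: add.commute)

lemma cmod_power2_add3_le:
  "(cmod (x + y + z))\<^sup>2 \<le> 3 * ((cmod x)\<^sup>2 + (cmod y)\<^sup>2 + (cmod z)\<^sup>2)"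
proof -
  have "cmod (x + y + z) \<le> cmod x + cmod y + cmod z"
    by (intro order.trans[OF norm_triangle_ineq] add_right_mono norm_triangle_ineq)
  then have "(cmod (x + y + z))\<^sup>2 \<le> (cmod x + cmod y + cmod z)\<^sup>2"
    by (intro power_mono) auto
  also have "\<dots> \<le> 3 * ((cmod x)\<^sup>2 + (cmod y)\<^sup>2 + (cmod z)\<^sup>2)"
    using zero_le_power2[of "cmod x - cmod y"] zero_le_power2[of "cmod y - cmod z"]
      zero_le_power2[of "cmod x - cmod z"]
    by (simp add: power2_eq_square algebra_simps)
  finally show ?thesis .
qed

text \<open>
  Translation is an isometry of \<open>L\<^sup>2\<close>, so replacing \<open>g\<close> by \<open>k m\<close> costs the same in both terms
  of the difference, uniformly in the shift: a standard three-part estimate.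
\<close>

lemma L2_translation_continuous_limit:
  assumes [measurable]: "g \<in> borel_measurable borel" "\<And>m. k m \<in> borel_measurable borel"
    and k: "\<And>m::nat. L2_translation_continuous (k m)"
    and lim: "(\<lambda>m. \<integral>\<^sup>+t. ennreal ((cmod (k m t - g t))\<^sup>2) \<partial>lborel) \<longlonglongrightarrow> 0"
  shows "L2_translation_continuous g"
  unfolding L2_translation_continuous_def
proof (intro allI impI)
  fix h :: "nat \<Rightarrow> real" assume h: "h \<longlonglongrightarrow> 0"
  define D where "D m = (\<integral>\<^sup>+t. ennreal ((cmod (k m t - g t))\<^sup>2) \<partial>lborel)" for m
  define \<tau> where "\<tau> q n = (\<integral>\<^sup>+t. ennreal ((cmod (q (t + h n) - q t))\<^sup>2) \<partial>lborel)"
    for q :: "real \<Rightarrow> complex" and n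
  have le: "\<tau> g n \<le> 6 * D m + 3 * \<tau> (k m) n" for m n
  proof -
    have "(cmod (g (t + h n) - g t))\<^sup>2 \<le> 3 * ((cmod (k m (t + h n) - g (t + h n)))\<^sup>2 +
       (cmod (k m (t + h n) - k m t))\<^sup>2 + (cmod (k m t - g t))\<^sup>2)" for t
      using cmod_power2_add3_le[of "g (t + h n) - k m (t + h n)" "k m (t + h n) - k m t" "k m t - g t"]
      by (simp add: norm_minus_commute)
    then have "\<tau> g n \<le> (\<integral>\<^sup>+t. 3 * (ennreal ((cmod (k m (t + h n) - g (t + h n)))\<^sup>2) +
       ennreal ((cmod (k m (t + h n) - k m t))\<^sup>2) + ennreal ((cmod (k m t - g t))\<^sup>2)) \<partial>lborel)"
      unfolding \<tau>_def
      by (intro nn_integral_mono) (simp add: ennreal_plus[symmetric] ennreal_mult'[symmetric] flip: ennreal_numeral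
             del: ennreal_plus)
    also have "\<dots> = 3 * ((\<integral>\<^sup>+t. ennreal ((cmod (k m (t + h n) - g (t + h n)))\<^sup>2) \<partial>lborel) + \<tau> (k m) n + D m)"
      unfolding \<tau>_def D_def by (simp add: nn_integral_cmult nn_integral_add)
    also have "(\<integral>\<^sup>+t. ennreal ((cmod (k m (t + h n) - g (t + h n)))\<^sup>2) \<partial>lborel) = D m"
      unfolding D_def
      by (rule nn_integral_lborel_shift[of "\<lambda>t. ennreal ((cmod (k m t - g t))\<^sup>2)"]) measurable
    also have "3 * (D m + \<tau> (k m) n + D m) = 6 * D m + 3 * \<tau> (k m) n"
      by (simp add: algebra_simps flip: mult_2)
    finally show ?thesis .
  qed
  show "\<tau> g \<longlonglongrightarrow> 0"
  proof (rule order_tendstoI)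
    fix a :: ennreal assume "0 < a"
    then obtain b where b: "0 < b" "b < a" using dense by blast
    then obtain r where r: "b = ennreal r" "r > 0"
      by (cases b) (auto simp: top.not_eq_extremum)
    have "(\<lambda>m. 6 * D m) \<longlonglongrightarrow> 6 * 0"
      using lim unfolding D_def by (intro ennreal_tendsto_cmult) auto
    then have "\<forall>\<^sub>F m in sequentially. 6 * D m < ennreal (r/2)"
      using r by (intro order_tendstoD) auto
    then obtain m where m: "6 * D m < ennreal (r/2)"
      by (auto simp: eventually_sequentially)
    have "\<tau> (k m) \<longlonglongrightarrow> 0"
      using k[of m] h unfolding L2_translation_continuous_def \<tau>_def by auto
    then have "(\<lambda>n. 3 * \<tau> (k m) n) \<longlonglongrightarrow> 3 * 0"
      by (intro ennreal_tendsto_cmult) auto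
    then have "\<forall>\<^sub>F n in sequentially. 3 * \<tau> (k m) n < ennreal (r/2)"
      using r by (intro order_tendstoD) auto
    then show "\<forall>\<^sub>F n in sequentially. \<tau> g n < a"
    proof eventually_elim
      case (elim n)
      have "\<tau> g n \<le> ennreal (r/2) + ennreal (r/2)"
        using le[of n m] m elim by (meson add_mono less_imp_le order_trans)
      also have "\<dots> = b" using r by (simp flip: ennreal_plus)
      finally show ?case using b by simp
    qed
  qed simp
qed

text \<open>
  The base case: a bounded sequence of shifts keeps the supports inside one compact interval, so the
  integrands converge pointwise below one integrable bound.
\<close>

lemma L2_translation_continuous_compact_support:
  assumes cont: "continuous_on UNIV k"
    and supp: "\<And>t. \<bar>t\<bar> > r \<Longrightarrow> k t = 0" and bound: "\<And>t. cmod (k t) \<le> C"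
  shows "L2_translation_continuous k"
  unfolding L2_translation_continuous_def
proof (intro allI impI)
  fix h :: "nat \<Rightarrow> real" assume h: "h \<longlonglongrightarrow> 0"
  have [measurable]: "k \<in> borel_measurable borel"
    using cont by (rule borel_measurable_continuous_onI)
  obtain B where B: "\<And>n. \<bar>h n\<bar> \<le> B"
    using convergent_imp_Bseq[OF convergentI[OF h]] by (auto simp: Bseq_def)
  have "(\<lambda>n. \<integral>\<^sup>+t. ennreal ((cmod (k (t + h n) - k t))\<^sup>2) \<partial>lborel) \<longlonglongrightarrow>
        (\<integral>\<^sup>+(t::real). 0 \<partial>lborel)"
  proof (rule nn_integral_dominated_convergence[where w =
        "\<lambda>t. ennreal ((2 * C)\<^sup>2) * indicator {-(\<bar>r\<bar> + B) .. \<bar>r\<bar> + B} t"])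
    fix n
    show "AE t in lborel. ennreal ((cmod (k (t + h n) - k t))\<^sup>2) \<le>
         ennreal ((2 * C)\<^sup>2) * indicator {-(\<bar>r\<bar> + B) .. \<bar>r\<bar> + B} t"
    proof (intro AE_I2)
      fix t
      show "ennreal ((cmod (k (t + h n) - k t))\<^sup>2) \<le>
         ennreal ((2 * C)\<^sup>2) * indicator {-(\<bar>r\<bar> + B) .. \<bar>r\<bar> + B} t"
      proof (cases "t \<in> {-(\<bar>r\<bar> + B) .. \<bar>r\<bar> + B}")
        case True
        have "cmod (k (t + h n) - k t) \<le> 2 * C"
          using norm_triangle_ineq4[of "k (t + h n)" "k t"] bound[of t] bound[of "t + h n"] by linarith
        then have "(cmod (k (t + h n) - k t))\<^sup>2 \<le> (2 * C)\<^sup>2"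
          by (intro power_mono) auto
        then show ?thesis using True by (simp add: ennreal_leI)
      next
        case False
        then have "\<bar>t\<bar> > r" "\<bar>t + h n\<bar> > r" using B[of n] by auto
        then show ?thesis by (simp add: supp)
      qed
    qed
  next
    show "(\<integral>\<^sup>+t. ennreal ((2 * C)\<^sup>2) * indicator {-(\<bar>r\<bar> + B) .. \<bar>r\<bar> + B} t \<partial>lborel) < \<infinity>"
      by (subst nn_integral_cmult_indicator) (auto simp: emeasure_lborel_Icc_eq ennreal_mult_less_top)
    have "(\<lambda>n. ennreal ((cmod (k (t + h n) - k t))\<^sup>2)) \<longlonglongrightarrow> 0" for t
    proof -
      have "(\<lambda>n. t + h n) \<longlonglongrightarrow> t" using tendsto_add[OF tendsto_const h, of t] by simp
      then have "(\<lambda>n. k (t + h n)) \<longlonglongrightarrow> k t"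
        using cont by (intro continuous_on_tendsto_compose[OF cont]) auto
      then have "(\<lambda>n. ennreal ((cmod (k (t + h n) - k t))\<^sup>2)) \<longlonglongrightarrow> ennreal ((cmod (k t - k t))\<^sup>2)"
        by (intro tendsto_intros)
      then show ?thesis by simp
    qed
    then show "AE t in lborel. (\<lambda>n. ennreal ((cmod (k (t + h n) - k t))\<^sup>2)) \<longlonglongrightarrow> 0"
      by simp
  qed measurable
  then show "(\<lambda>n. \<integral>\<^sup>+t. ennreal ((cmod (k (t + h n) - k t))\<^sup>2) \<partial>lborel) \<longlonglongrightarrow> 0"
    by simp
qed

text \<open>
  Clipping the values to the disc of radius \<open>m\<close> and multiplying by a trapezoidal cutoff. Both
  operations are continuous, so truncation preserves continuity as well as pointwise limits, and its
  results are bounded and compactly supported.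
\<close>

definition truncated :: "nat \<Rightarrow> (real \<Rightarrow> complex) \<Rightarrow> real \<Rightarrow> complex" where
  "truncated m g t = max 0 (min 1 (real m + 1 - \<bar>t\<bar>)) *\<^sub>R closest_point (cball 0 (real m)) (g t)"

lemma continuous_on_closest_point_cball:
  "continuous_on UNIV (closest_point (cball 0 (real m) :: complex set))"
  by (rule continuous_on_closest_point) auto

lemma borel_measurable_closest_point_cball [measurable]:
  "closest_point (cball 0 (real m) :: complex set) \<in> borel_measurable borel"
  by (rule borel_measurable_continuous_onI continuous_on_closest_point_cball)+

lemma borel_measurable_truncated [measurable]:
  assumes [measurable]: "g \<in> borel_measurable borel"
  shows "truncated m g \<in> borel_measurable borel"
  unfolding truncated_def[abs_def] by measurable

lemma norm_closest_point_cball_le: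
  "cmod (closest_point (cball 0 (real m)) z) \<le> real m"
  using closest_point_in_set[of "cball 0 (real m)" z] by (auto simp: dist_norm)

lemma norm_truncated_le: "cmod (truncated m g t) \<le> real m"
proof -
  have "\<bar>max 0 (min 1 (real m + 1 - \<bar>t\<bar>))\<bar> * cmod (closest_point (cball 0 (real m)) (g t)) \<le> 1 * real m"
    by (rule mult_mono[OF _ norm_closest_point_cball_le]) auto
  then show ?thesis by (simp add: truncated_def)
qed

lemma truncated_eq_0: "\<bar>t\<bar> > real m + 1 \<Longrightarrow> truncated m g t = 0"
  by (simp add: truncated_def)

lemma truncated_eq: "\<bar>t\<bar> \<le> real m \<Longrightarrow> cmod (g t) \<le> real m \<Longrightarrow> truncated m g t = g t"
  by (simp add: truncated_def closest_point_self)

lemma norm_truncated_le_norm: "cmod (truncated m g t) \<le> cmod (g t)"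
proof (cases "cmod (g t) \<le> real m")
  case True
  have "\<bar>max 0 (min 1 (real m + 1 - \<bar>t\<bar>))\<bar> * cmod (g t) \<le> 1 * cmod (g t)"
    by (rule mult_right_mono) auto
  then show ?thesis using True by (simp add: truncated_def closest_point_self)
next
  case False
  then show ?thesis using norm_truncated_le[of m g t] by linarith
qed

lemma continuous_on_truncated:
  assumes "continuous_on UNIV g"
  shows "continuous_on UNIV (truncated m g)"
proof -
  have "continuous_on UNIV (\<lambda>t. closest_point (cball 0 (real m)) (g t))"
    by (rule continuous_on_compose2[OF continuous_on_closest_point_cball assms]) auto
  then show ?thesis
    unfolding truncated_def[abs_def] by (intro continuous_intros)
qed

lemma tendsto_truncated:
  assumes "(\<lambda>n. p n t) \<longlonglongrightarrow> g t"
  shows "(\<lambda>n. truncated m (p n) t) \<longlonglongrightarrow> truncated m g t"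
proof -
  have "(\<lambda>n. closest_point (cball 0 (real m)) (p n t)) \<longlonglongrightarrow> closest_point (cball 0 (real m)) (g t)"
    by (rule continuous_on_tendsto_compose[OF continuous_on_closest_point_cball assms]) auto
  then show ?thesis
    unfolding truncated_def by (intro tendsto_intros)
qed

text \<open>
  A measurable function is an almost everywhere limit of continuous functions. Those limits need not
  be dominated, but after truncation they are, which makes the convergence take place in \<open>L\<^sup>2\<close>.
\<close>

lemma L2_translation_continuous_truncated:
  assumes [measurable]: "g \<in> borel_measurable borel"
  shows "L2_translation_continuous (truncated m g)"
proof -
  have "g \<in> borel_measurable lebesgue" using assms by (intro measurable_completion) auto
  then have "g measurable_on UNIV" by (intro lebesgue_measurable_imp_measurable_on) auto
  then obtain N p where N: "negligible N" and p: "\<And>n::nat. continuous_on UNIV (p n)"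
    and lim: "\<And>x. x \<notin> N \<Longrightarrow> (\<lambda>n. p n x) \<longlonglongrightarrow> g x"
    unfolding measurable_on_def by auto
  have [measurable]: "p n \<in> borel_measurable borel" for n
    using p by (rule borel_measurable_continuous_onI)
  have AE_N: "AE t in lborel. t \<notin> N"
    using AE_not_in[of N lebesgue] N unfolding negligible_iff_null_sets AE_completion_iff by blast
  have "(\<lambda>n. \<integral>\<^sup>+t. ennreal ((cmod (truncated m (p n) t - truncated m g t))\<^sup>2) \<partial>lborel) \<longlonglongrightarrow>
      (\<integral>\<^sup>+(t::real). 0 \<partial>lborel)"
  proof (rule nn_integral_dominated_convergence[where w =
        "\<lambda>t. ennreal ((2 * real m)\<^sup>2) * indicator {-(real m + 1) .. real m + 1} t"])
    fix n
    have "ennreal ((cmod (truncated m (p n) t - truncated m g t))\<^sup>2) \<le>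
         ennreal ((2 * real m)\<^sup>2) * indicator {-(real m + 1) .. real m + 1} t" for t
    proof (cases "t \<in> {-(real m + 1) .. real m + 1}")
      case True
      have "cmod (truncated m (p n) t - truncated m g t) \<le> 2 * real m"
        using norm_triangle_ineq4[of "truncated m (p n) t" "truncated m g t"]
          norm_truncated_le[of m "p n" t] norm_truncated_le[of m g t] by linarith
      then have "(cmod (truncated m (p n) t - truncated m g t))\<^sup>2 \<le> (2 * real m)\<^sup>2"
        by (intro power_mono) auto
      then show ?thesis using True by (simp add: ennreal_leI)
    next
      case False
      then have "\<bar>t\<bar> > real m + 1" by auto
      then show ?thesis by (simp add: truncated_eq_0)
    qed
    then show "AE t in lborel. ennreal ((cmod (truncated m (p n) t - truncated m g t))\<^sup>2) \<le>
         ennreal ((2 * real m)\<^sup>2) * indicator {-(real m + 1) .. real m + 1} t" by simp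
  next
    show "(\<integral>\<^sup>+t. ennreal ((2 * real m)\<^sup>2) * indicator {-(real m + 1) .. real m + 1} t \<partial>lborel) < \<infinity>"
      by (subst nn_integral_cmult_indicator) (auto simp: emeasure_lborel_Icc_eq ennreal_mult_less_top)
    have "(\<lambda>n. ennreal ((cmod (truncated m (p n) t - truncated m g t))\<^sup>2)) \<longlonglongrightarrow> 0" if "t \<notin> N" for t
    proof -
      have "(\<lambda>n. ennreal ((cmod (truncated m (p n) t - truncated m g t))\<^sup>2)) \<longlonglongrightarrow>
          ennreal ((cmod (truncated m g t - truncated m g t))\<^sup>2)"
        using tendsto_truncated[of p t g m, OF lim[OF that]] by (intro tendsto_intros)
      then show ?thesis by simp
    qed
    then show "AE t in lborel. (\<lambda>n. ennreal ((cmod (truncated m (p n) t - truncated m g t))\<^sup>2)) \<longlonglongrightarrow> 0"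
      using AE_N by auto
  qed measurable
  then have lim: "(\<lambda>n. \<integral>\<^sup>+t. ennreal ((cmod (truncated m (p n) t - truncated m g t))\<^sup>2) \<partial>lborel) \<longlonglongrightarrow> 0"
    by simp
  have "L2_translation_continuous (truncated m (p n))" for n
    by (rule L2_translation_continuous_compact_support[OF continuous_on_truncated[OF p]
          truncated_eq_0 norm_truncated_le])
  then show ?thesis
    by (rule L2_translation_continuous_limit[OF _ _ _ lim, rotated 2]) measurable
qed

text \<open>
  Truncations approximate in \<open>L\<^sup>2\<close>: they are pointwise eventually equal to \<open>g\<close> and dominated
  by \<open>\<bar>g\<bar>\<close>.
\<close>

lemma L2_imp_translation_continuous:
  assumes [measurable]: "g \<in> borel_measurable borel"
    and fin: "(\<integral>\<^sup>+t. ennreal ((cmod (g t))\<^sup>2) \<partial>lborel) < \<infinity>"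
  shows "L2_translation_continuous g"
proof -
  have "(\<lambda>m. \<integral>\<^sup>+t. ennreal ((cmod (truncated m g t - g t))\<^sup>2) \<partial>lborel) \<longlonglongrightarrow>
      (\<integral>\<^sup>+(t::real). 0 \<partial>lborel)"
  proof (rule nn_integral_dominated_convergence[where w = "\<lambda>t. 4 * ennreal ((cmod (g t))\<^sup>2)"])
    fix m
    have "ennreal ((cmod (truncated m g t - g t))\<^sup>2) \<le> 4 * ennreal ((cmod (g t))\<^sup>2)" for t
    proof -
      have "cmod (truncated m g t - g t) \<le> 2 * cmod (g t)"
        using norm_triangle_ineq4[of "truncated m g t" "g t"] norm_truncated_le_norm[of m g t]
        by linarith
      then have "(cmod (truncated m g t - g t))\<^sup>2 \<le> (2 * cmod (g t))\<^sup>2"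
        by (intro power_mono) auto
      then have "ennreal ((cmod (truncated m g t - g t))\<^sup>2) \<le> ennreal (4 * (cmod (g t))\<^sup>2)"
        by (intro ennreal_leI) (simp add: power_mult_distrib)
      also have "\<dots> = 4 * ennreal ((cmod (g t))\<^sup>2)"
        by (subst ennreal_mult) auto
      finally show ?thesis .
    qed
    then show "AE t in lborel. ennreal ((cmod (truncated m g t - g t))\<^sup>2) \<le> 4 * ennreal ((cmod (g t))\<^sup>2)"
      by simp
  next
    show "(\<integral>\<^sup>+t. 4 * ennreal ((cmod (g t))\<^sup>2) \<partial>lborel) < \<infinity>"
      using fin by (simp add: nn_integral_cmult ennreal_mult_less_top)
    have "(\<lambda>m. ennreal ((cmod (truncated m g t - g t))\<^sup>2)) \<longlonglongrightarrow> 0" for t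
    proof (rule tendsto_eventually)
      obtain m0 :: nat where m0: "max \<bar>t\<bar> (cmod (g t)) \<le> real m0" using real_arch_simple by blast
      show "\<forall>\<^sub>F m in sequentially. ennreal ((cmod (truncated m g t - g t))\<^sup>2) = 0"
        using eventually_ge_at_top[of m0]
      proof eventually_elim
        case (elim m)
        then have "real m0 \<le> real m" by simp
        then have "truncated m g t = g t" using m0 by (intro truncated_eq) linarith+
        then show ?case by simp
      qed
    qed
    then show "AE t in lborel. (\<lambda>m. ennreal ((cmod (truncated m g t - g t))\<^sup>2)) \<longlonglongrightarrow> 0" by simp
  qed measurable
  then have lim: "(\<lambda>m. \<integral>\<^sup>+t. ennreal ((cmod (truncated m g t - g t))\<^sup>2) \<partial>lborel) \<longlonglongrightarrow> 0"
    by simp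
  show ?thesis
    by (rule L2_translation_continuous_limit[OF _ _ L2_translation_continuous_truncated lim]) measurable
qed

section \<open>The Plancherel inequality\<close>

definition fourier :: "(real \<Rightarrow> complex) \<Rightarrow> real \<Rightarrow> complex" where
  "fourier g \<xi> = (LINT t|lborel. g t * cis (-(\<xi> * t)))"

definition autocorrelation :: "(real \<Rightarrow> complex) \<Rightarrow> real \<Rightarrow> complex" where
  "autocorrelation g x = (LINT s|lborel. g s * cnj (g (s - x)))"

lemma borel_measurable_cis [measurable]: "cis \<in> borel_measurable borel"
  by (intro borel_measurable_continuous_onI continuous_intros)

lemma borel_measurable_cnj [measurable]: "cnj \<in> borel_measurable borel"
  by (intro borel_measurable_continuous_onI continuous_intros)

lemma borel_measurable_fourier [measurable]:
  assumes [measurable]: "g \<in> borel_measurable borel"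
  shows "fourier g \<in> borel_measurable borel"
  unfolding fourier_def[abs_def] by measurable

lemma borel_measurable_autocorrelation [measurable]:
  assumes [measurable]: "g \<in> borel_measurable borel"
  shows "autocorrelation g \<in> borel_measurable borel"
  unfolding autocorrelation_def[abs_def] by measurable

text \<open>
  By Tonelli the integral of the modulus is the square of the \<open>L\<^sup>1\<close> norm.
\<close>

lemma integrable_autocorrelation_kernel:
  fixes g :: "real \<Rightarrow> complex"
  assumes g: "integrable lborel g"
  shows "integrable (lborel \<Otimes>\<^sub>M lborel) (\<lambda>(s, x). g s * cnj (g (s - x)))"
proof (rule integrableI_bounded)
  have [measurable]: "g \<in> borel_measurable borel" using borel_measurable_integrable[OF g] by simp
  show "(\<lambda>(s, x). g s * cnj (g (s - x))) \<in> borel_measurable (lborel \<Otimes>\<^sub>M lborel)"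
    by measurable
  define C where "C = (\<integral>\<^sup>+t. ennreal (cmod (g t)) \<partial>lborel)"
  have C: "C < \<infinity>" using g unfolding C_def integrable_iff_bounded by simp
  have refl: "(\<integral>\<^sup>+x. ennreal (cmod (g (s - x))) \<partial>lborel) = C" for s
    using nn_integral_real_affine[of "\<lambda>t. ennreal (cmod (g t))" "-1" s] unfolding C_def by simp
  have "(\<integral>\<^sup>+p. ennreal (cmod (case p of (s, x) \<Rightarrow> g s * cnj (g (s - x)))) \<partial>(lborel \<Otimes>\<^sub>M lborel)) =
      (\<integral>\<^sup>+s. \<integral>\<^sup>+x. ennreal (cmod (g s)) * ennreal (cmod (g (s - x))) \<partial>lborel \<partial>lborel)"
    by (subst lborel.nn_integral_fst[symmetric]) (auto simp: norm_mult ennreal_mult)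
  also have "\<dots> = C * C"
    by (simp add: nn_integral_cmult nn_integral_multc refl) (simp add: C_def)
  also have "\<dots> < \<infinity>" using C by (simp add: ennreal_mult_less_top)
  finally show "(\<integral>\<^sup>+p. ennreal (cmod (case p of (s, x) \<Rightarrow> g s * cnj (g (s - x)))) \<partial>(lborel \<Otimes>\<^sub>M lborel)) < \<infinity>" .
qed

lemma integrable_autocorrelation:
  assumes g: "integrable lborel g"
  shows "integrable lborel (autocorrelation g)"
  using lborel_pair.integrable_snd[OF integrable_autocorrelation_kernel[OF g]]
  unfolding autocorrelation_def[abs_def] .

text \<open>
  The power spectrum is the Fourier transform of the autocorrelation: substitute \<open>t = s - x\<close> in the
  second factor and exchange the integrals.
\<close>

lemma fourier_mult_cnj_eq_autocorrelation:
  assumes g: "integrable lborel g"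
  shows "fourier g \<xi> * cnj (fourier g \<xi>) = (LINT x|lborel. autocorrelation g x * cis (-(\<xi> * x)))"
proof -
  have [measurable]: "g \<in> borel_measurable borel" using borel_measurable_integrable[OF g] by simp
  have cnj_fourier: "cnj (fourier g \<xi>) = (LINT x|lborel. cnj (g (s - x)) * cis (\<xi> * (s - x)))" for s
  proof -
    have "cnj (fourier g \<xi>) = (LINT t|lborel. cnj (g t) * cis (\<xi> * t))"
      unfolding fourier_def
      using Bochner_Integration.integral_cnj[of lborel "\<lambda>t. g t * cis (-(\<xi> * t))"] by (simp add: cis_cnj)
    also have "\<dots> = (LINT x|lborel. cnj (g (s - x)) * cis (\<xi> * (s - x)))"
      using lborel_integral_real_affine[of "-1" "\<lambda>t. cnj (g t) * cis (\<xi> * t)" s] by simp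
    finally show ?thesis .
  qed
  have "fourier g \<xi> * cnj (fourier g \<xi>) = (LINT s|lborel. g s * cis (-(\<xi> * s)) * cnj (fourier g \<xi>))"
    unfolding fourier_def by simp
  also have "\<dots> = (LINT s|lborel. LINT x|lborel. g s * cnj (g (s - x)) * cis (-(\<xi> * x)))"
  proof (intro Bochner_Integration.integral_cong refl)
    fix s
    have "g s * cis (-(\<xi> * s)) * cnj (fourier g \<xi>) =
        (LINT x|lborel. g s * cis (-(\<xi> * s)) * (cnj (g (s - x)) * cis (\<xi> * (s - x))))"
      by (subst cnj_fourier[of s]) simp
    also have "\<dots> = (LINT x|lborel. g s * cnj (g (s - x)) * cis (-(\<xi> * x)))"
    proof (intro Bochner_Integration.integral_cong refl)
      fix x
      have "cis (-(\<xi> * s)) * cis (\<xi> * (s - x)) = cis (-(\<xi> * x))"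
        by (simp add: cis_mult algebra_simps)
      then show "g s * cis (-(\<xi> * s)) * (cnj (g (s - x)) * cis (\<xi> * (s - x))) =
          g s * cnj (g (s - x)) * cis (-(\<xi> * x))"
        by (metis (no_types, lifting) mult.assoc mult.left_commute)
    qed
    finally show "g s * cis (-(\<xi> * s)) * cnj (fourier g \<xi>) =
        (LINT x|lborel. g s * cnj (g (s - x)) * cis (-(\<xi> * x)))" .
  qed
  also have "\<dots> = (LINT x|lborel. LINT s|lborel. g s * cnj (g (s - x)) * cis (-(\<xi> * x)))"
    by (rule lborel_pair.Fubini_integral[symmetric],
        rule Bochner_Integration.integrable_bound[OF integrable_autocorrelation_kernel[OF g]])
      (auto simp: norm_mult)
  finally show ?thesis unfolding autocorrelation_def by simp
qed

text \<open>
  Averaging over a Gaussian frequency makes the frequency integral absolutely convergent, so it can be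
  carried out before the integral over \<open>x\<close>; the characteristic function of the normal distribution
  is again Gaussian. For large \<open>R\<close> the right-hand side concentrates at \<open>x = 0\<close>, where the
  autocorrelation is the squared \<open>L\<^sup>2\<close> norm.
\<close>

lemma normal_average_fourier_power2:
  assumes g: "integrable lborel g"
  shows "(LINT y|std_normal_distribution. (cmod (fourier g (R * y)))\<^sup>2) =
         (LINT x|lborel. Re (autocorrelation g x) * exp (-(R * x)\<^sup>2 / 2))"
proof -
  interpret N: real_distribution std_normal_distribution by (rule real_dist_normal_dist)
  interpret P: pair_sigma_finite lborel std_normal_distribution ..
  have [measurable]: "g \<in> borel_measurable borel" using borel_measurable_integrable[OF g] by simp
  have A: "integrable lborel (autocorrelation g)" by (rule integrable_autocorrelation[OF g])
  have A': "integrable lborel (\<lambda>x. autocorrelation g x * of_real (exp (-(R * x)\<^sup>2 / 2)))"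
    by (rule Bochner_Integration.integrable_bound[OF A]) (auto simp: norm_mult mult_left_le)
  have "integrable (lborel \<Otimes>\<^sub>M std_normal_distribution) (\<lambda>(x, y). autocorrelation g x)"
    unfolding integrable_iff_bounded
  proof
    show "(\<lambda>(x, y). autocorrelation g x) \<in> borel_measurable (lborel \<Otimes>\<^sub>M std_normal_distribution)"
      by measurable
    have "(\<integral>\<^sup>+p. ennreal (cmod (case p of (x, y) \<Rightarrow> autocorrelation g x)) \<partial>(lborel \<Otimes>\<^sub>M std_normal_distribution)) =
        (\<integral>\<^sup>+x. \<integral>\<^sup>+y. ennreal (cmod (autocorrelation g x)) \<partial>std_normal_distribution \<partial>lborel)"
      by (subst N.nn_integral_fst[symmetric]) auto
    also have "\<dots> = (\<integral>\<^sup>+x. ennreal (cmod (autocorrelation g x)) \<partial>lborel)"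
      using N.emeasure_space_1 by simp
    also have "\<dots> < \<infinity>" using A unfolding integrable_iff_bounded by simp
    finally show "(\<integral>\<^sup>+p. ennreal (cmod (case p of (x, y) \<Rightarrow> autocorrelation g x)) \<partial>(lborel \<Otimes>\<^sub>M std_normal_distribution)) < \<infinity>" .
  qed
  then have int: "integrable (lborel \<Otimes>\<^sub>M std_normal_distribution)
      (\<lambda>(x, y). autocorrelation g x * cis (-(R * y * x)))"
    by (rule Bochner_Integration.integrable_bound) (auto simp: norm_mult)
  have "complex_of_real (LINT y|std_normal_distribution. (cmod (fourier g (R * y)))\<^sup>2) =
      (LINT y|std_normal_distribution. fourier g (R * y) * cnj (fourier g (R * y)))"
    by (subst integral_complex_of_real[symmetric]) (simp only: complex_norm_square)
  also have "\<dots> = (LINT y|std_normal_distribution. LINT x|lborel. autocorrelation g x * cis (-(R * y * x)))"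
    by (simp only: fourier_mult_cnj_eq_autocorrelation[OF g])
  also have "\<dots> = (LINT x|lborel. LINT y|std_normal_distribution. autocorrelation g x * cis (-(R * y * x)))"
    by (rule P.Fubini_integral[OF int])
  also have "\<dots> = (LINT x|lborel. autocorrelation g x * of_real (exp (-(R * x)\<^sup>2 / 2)))"
  proof (intro Bochner_Integration.integral_cong refl)
    fix x
    have "(LINT y|std_normal_distribution. cis (-(R * y * x))) = char std_normal_distribution (-(R * x))"
      unfolding char_def by (intro Bochner_Integration.integral_cong) (auto simp: cis_conv_exp algebra_simps)
    then show "(LINT y|std_normal_distribution. autocorrelation g x * cis (-(R * y * x))) =
        autocorrelation g x * of_real (exp (-(R * x)\<^sup>2 / 2))"
      by (simp add: char_std_normal_distribution)
  qed
  finally have "(LINT y|std_normal_distribution. (cmod (fourier g (R * y)))\<^sup>2) =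
      Re (LINT x|lborel. autocorrelation g x * of_real (exp (-(R * x)\<^sup>2 / 2)))"
    by (metis Re_complex_of_real)
  also have "\<dots> = (LINT x|lborel. Re (autocorrelation g x) * exp (-(R * x)\<^sup>2 / 2))"
    using A' by (subst integral_Re[symmetric]) auto
  finally show ?thesis .
qed

lemma integrable_mult_cnj_shift:
  fixes g :: "real \<Rightarrow> complex"
  assumes [measurable]: "g \<in> borel_measurable borel"
    and g2: "integrable lborel (\<lambda>t. (cmod (g t))\<^sup>2)"
  shows "integrable lborel (\<lambda>s. g s * cnj (g (s - x)))"
    and "integrable lborel (\<lambda>s. (cmod (g (s - x)))\<^sup>2)"
    and "(LINT s|lborel. (cmod (g (s - x)))\<^sup>2) = (LINT s|lborel. (cmod (g s))\<^sup>2)"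
proof -
  show sh: "integrable lborel (\<lambda>s. (cmod (g (s - x)))\<^sup>2)"
    using lborel_integrable_real_affine[OF g2, of 1 "-x"] by (simp add: algebra_simps)
  show "(LINT s|lborel. (cmod (g (s - x)))\<^sup>2) = (LINT s|lborel. (cmod (g s))\<^sup>2)"
    using lborel_integral_real_affine[of 1 "\<lambda>t. (cmod (g t))\<^sup>2" "-x"] by (simp add: algebra_simps)
  show "integrable lborel (\<lambda>s. g s * cnj (g (s - x)))"
  proof (rule Bochner_Integration.integrable_bound[OF Bochner_Integration.integrable_add[OF g2 sh]])
    have "cmod (g s * cnj (g (s - x))) \<le> (cmod (g s))\<^sup>2 + (cmod (g (s - x)))\<^sup>2" for s
      using sum_squares_bound[of "cmod (g s)" "cmod (g (s - x))"]
        mult_nonneg_nonneg[OF norm_ge_zero[of "g s"] norm_ge_zero[of "g (s - x)"]]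
      unfolding norm_mult complex_mod_cnj by linarith
    then show "AE s in lborel. cmod (g s * cnj (g (s - x))) \<le> norm ((cmod (g s))\<^sup>2 + (cmod (g (s - x)))\<^sup>2)"
      by simp
  qed measurable
qed

lemma power2_cmod_diff: "(cmod (a - b))\<^sup>2 = (cmod a)\<^sup>2 + (cmod b)\<^sup>2 - 2 * Re (a * cnj b)"
  unfolding cmod_power2 by (simp add: power2_eq_square algebra_simps)

text \<open>
  Polarisation turns continuity of translation into continuity of the autocorrelation at the
  origin.
\<close>

lemma Re_autocorrelation:
  assumes g: "g \<in> borel_measurable borel" "integrable lborel (\<lambda>t. (cmod (g t))\<^sup>2)"
  shows "integrable lborel (\<lambda>s. (cmod (g (s - x) - g s))\<^sup>2)"
    and "Re (autocorrelation g x) =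
      (LINT s|lborel. (cmod (g s))\<^sup>2) - (LINT s|lborel. (cmod (g (s - x) - g s))\<^sup>2) / 2"
proof -
  note sh = integrable_mult_cnj_shift[OF g, of x]
  have eq: "(cmod (g (s - x) - g s))\<^sup>2 =
      (cmod (g s))\<^sup>2 + (cmod (g (s - x)))\<^sup>2 - 2 * Re (g s * cnj (g (s - x)))" for s
    using power2_cmod_diff[of "g s" "g (s - x)"] by (simp add: norm_minus_commute)
  have Re: "integrable lborel (\<lambda>s. Re (g s * cnj (g (s - x))))"
    using sh(1) by (rule integrable_Re)
  show "integrable lborel (\<lambda>s. (cmod (g (s - x) - g s))\<^sup>2)"
    unfolding eq using g(2) sh(2) Re
    by (intro Bochner_Integration.integrable_diff Bochner_Integration.integrable_add integrable_mult_right) auto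
  have "(LINT s|lborel. (cmod (g (s - x) - g s))\<^sup>2) =
      (LINT s|lborel. (cmod (g s))\<^sup>2) + (LINT s|lborel. (cmod (g (s - x)))\<^sup>2) -
      2 * (LINT s|lborel. Re (g s * cnj (g (s - x))))"
    unfolding eq
    by (subst Bochner_Integration.integral_diff Bochner_Integration.integral_add integral_mult_right_zero;
        (intro Bochner_Integration.integrable_add integrable_mult_right g(2) sh(2) Re)?)+ simp
  moreover have "Re (autocorrelation g x) = (LINT s|lborel. Re (g s * cnj (g (s - x))))"
    unfolding autocorrelation_def by (rule integral_Re[OF sh(1), symmetric])
  ultimately show "Re (autocorrelation g x) =
      (LINT s|lborel. (cmod (g s))\<^sup>2) - (LINT s|lborel. (cmod (g (s - x) - g s))\<^sup>2) / 2"
    unfolding sh(3) by linarith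
qed

lemma Re_autocorrelation_tendsto:
  assumes g: "g \<in> borel_measurable borel" "integrable lborel (\<lambda>t. (cmod (g t))\<^sup>2)"
    and h: "h \<longlonglongrightarrow> 0"
  shows "(\<lambda>n. Re (autocorrelation g (h n))) \<longlonglongrightarrow> (LINT s|lborel. (cmod (g s))\<^sup>2)"
proof -
  define T where "T x = (LINT s|lborel. (cmod (g (s - x) - g s))\<^sup>2)" for x
  have "L2_translation_continuous g"
    using g by (intro L2_imp_translation_continuous) (auto simp: integrable_iff_bounded)
  moreover have "(\<lambda>n. - h n) \<longlonglongrightarrow> 0" using tendsto_minus[OF h] by simp
  ultimately have "(\<lambda>n. \<integral>\<^sup>+s. ennreal ((cmod (g (s + - h n) - g s))\<^sup>2) \<partial>lborel) \<longlonglongrightarrow> 0"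
    unfolding L2_translation_continuous_def by blast
  moreover have "(\<integral>\<^sup>+s. ennreal ((cmod (g (s + - x) - g s))\<^sup>2) \<partial>lborel) = ennreal (T x)" for x
    unfolding T_def using nn_integral_eq_integral[OF Re_autocorrelation(1)[OF g, of x]] by simp
  ultimately have "(\<lambda>n. ennreal (T (h n))) \<longlonglongrightarrow> ennreal 0" by simp
  moreover have "T x \<ge> 0" for x unfolding T_def by simp
  ultimately have "(\<lambda>n. T (h n)) \<longlonglongrightarrow> 0"
    by (subst (asm) tendsto_ennreal_iff) auto
  then have "(\<lambda>n. (LINT s|lborel. (cmod (g s))\<^sup>2) - T (h n) / 2) \<longlonglongrightarrow>
      (LINT s|lborel. (cmod (g s))\<^sup>2) - 0 / 2"
    by (intro tendsto_intros) auto
  then show ?thesis unfolding Re_autocorrelation(2)[OF g] T_def by simp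
qed

lemma abs_Re_autocorrelation_le:
  assumes g: "g \<in> borel_measurable borel" "integrable lborel (\<lambda>t. (cmod (g t))\<^sup>2)"
  shows "\<bar>Re (autocorrelation g x)\<bar> \<le> (LINT s|lborel. (cmod (g s))\<^sup>2)"
proof -
  note sh = integrable_mult_cnj_shift[OF g, of x]
  have "cmod (g (s - x) - g s) ^ 2 \<le> 2 * (cmod (g s))\<^sup>2 + 2 * (cmod (g (s - x)))\<^sup>2" for s
  proof -
    have "(cmod (g (s - x) - g s))\<^sup>2 + (cmod (g (s - x) + g s))\<^sup>2 = 2 * (cmod (g s))\<^sup>2 + 2 * (cmod (g (s - x)))\<^sup>2"
      unfolding cmod_power2 by (simp add: power2_eq_square algebra_simps)
    then show ?thesis by (smt (verit) zero_le_power2)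
  qed
  then have "(LINT s|lborel. (cmod (g (s - x) - g s))\<^sup>2) \<le>
      (LINT s|lborel. 2 * (cmod (g s))\<^sup>2 + 2 * (cmod (g (s - x)))\<^sup>2)"
    using Re_autocorrelation(1)[OF g, of x] g(2) sh(2) by (intro integral_mono) auto
  also have "\<dots> = 4 * (LINT s|lborel. (cmod (g s))\<^sup>2)"
    using g(2) sh(2,3) by simp
  finally have "(LINT s|lborel. (cmod (g (s - x) - g s))\<^sup>2) \<le> 4 * (LINT s|lborel. (cmod (g s))\<^sup>2)" .
  moreover have "(LINT s|lborel. (cmod (g (s - x) - g s))\<^sup>2) \<ge> 0" by simp
  ultimately show ?thesis unfolding Re_autocorrelation(2)[OF g] by linarith
qed

lemma ennreal_integral_le_nn_integral:
  fixes f :: "'a \<Rightarrow> real"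
  assumes "\<And>x. 0 \<le> f x"
  shows "ennreal (integral\<^sup>L M f) \<le> (\<integral>\<^sup>+x. ennreal (f x) \<partial>M)"
  using assms by (cases "integrable M f") (auto simp: nn_integral_eq_integral not_integrable_integral_eq)

text \<open>
  Bounding the Gaussian density by its maximum \<open>1 / sqrt (2 * pi)\<close> in
  \<open>normal_average_fourier_power2\<close>, rescaled by \<open>R n\<close>, shows that a mollified squared norm of \<open>g\<close>
  is at most the integral of the power spectrum, and letting \<open>R n\<close> tend to infinity recovers the
  squared norm itself. This half of Plancherel's theorem is the only one that an uncertainty inequality
  needs.
\<close>

lemma plancherel_le:
  assumes g: "integrable lborel g" "integrable lborel (\<lambda>t. (cmod (g t))\<^sup>2)"
  shows "ennreal (2 * pi * (LINT t|lborel. (cmod (g t))\<^sup>2)) \<le>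
         (\<integral>\<^sup>+\<xi>. ennreal ((cmod (fourier g \<xi>))\<^sup>2) \<partial>lborel)"
proof -
  have [measurable]: "g \<in> borel_measurable borel" using borel_measurable_integrable[OF g(1)] by simp
  note gm = \<open>g \<in> borel_measurable borel\<close>
  define B where "B x = Re (autocorrelation g x)" for x
  define N where "N = (LINT t|lborel. (cmod (g t))\<^sup>2)"
  define R where "R n = real n + 1" for n
  define c where "c n = (LINT z|lborel. B (z / R n) * std_normal_density z)" for n
  define J where "J = (\<integral>\<^sup>+\<xi>. ennreal ((cmod (fourier g \<xi>))\<^sup>2) \<partial>lborel)"
  have [measurable]: "B \<in> borel_measurable borel" unfolding B_def[abs_def] by measurable
  have R0: "R n > 0" for n unfolding R_def by simp
  have Rlim: "(\<lambda>n. z / R n) \<longlonglongrightarrow> 0" for z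
    unfolding R_def using LIMSEQ_ignore_initial_segment[OF lim_const_over_n[of z], of 1]
    by (simp add: add.commute)
  have \<phi>: "integrable lborel std_normal_density" "integral\<^sup>L lborel std_normal_density = 1"
    by (auto simp: integrable_normal_density integral_normal_density)
  have "c \<longlonglongrightarrow> (LINT z|lborel. N * std_normal_density z)"
    unfolding c_def
  proof (rule integral_dominated_convergence[where w = "\<lambda>z. N * std_normal_density z"])
    show "AE z in lborel. (\<lambda>n. B (z / R n) * std_normal_density z) \<longlonglongrightarrow> N * std_normal_density z"
      unfolding B_def N_def
      by (intro AE_I2 tendsto_mult tendsto_const Re_autocorrelation_tendsto gm g(2) Rlim)
    show "AE z in lborel. norm (B (z / R n) * std_normal_density z) \<le> N * std_normal_density z" for n
      using abs_Re_autocorrelation_le[OF gm g(2)]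
      by (auto simp: abs_mult B_def N_def intro!: mult_right_mono)
  qed (use \<phi> in auto)
  then have c_lim: "c \<longlonglongrightarrow> N" using \<phi> by simp
  have c_le: "ennreal (2 * pi * c n) \<le> J" for n
  proof -
    define L where "L = (LINT y|std_normal_distribution. (cmod (fourier g (R n * y)))\<^sup>2)"
    have "L = (LINT x|lborel. B x * exp (-(R n * x)\<^sup>2 / 2))"
      unfolding L_def B_def by (rule normal_average_fourier_power2[OF g(1)])
    also have "\<dots> = (1 / R n) * (LINT z|lborel. B (z / R n) * exp (- z\<^sup>2 / 2))"
      using lborel_integral_real_affine[of "1 / R n" "\<lambda>x. B x * exp (-(R n * x)\<^sup>2 / 2)" 0] R0[of n]
      by simp
    also have "(LINT z|lborel. B (z / R n) * exp (- z\<^sup>2 / 2)) =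
        (LINT z|lborel. sqrt (2 * pi) * (B (z / R n) * std_normal_density z))"
      by (intro Bochner_Integration.integral_cong) (auto simp: std_normal_density_def)
    also have "\<dots> = sqrt (2 * pi) * c n"
      unfolding c_def by simp
    finally have L: "L = sqrt (2 * pi) / R n * c n" by simp
    have "ennreal L \<le> (\<integral>\<^sup>+y. ennreal ((cmod (fourier g (R n * y)))\<^sup>2) \<partial>std_normal_distribution)"
      unfolding L_def by (rule ennreal_integral_le_nn_integral) simp
    also have "\<dots> = (\<integral>\<^sup>+y. ennreal (std_normal_density y) * ennreal ((cmod (fourier g (R n * y)))\<^sup>2) \<partial>lborel)"
      by (subst nn_integral_density) auto
    also have "\<dots> \<le> (\<integral>\<^sup>+y. ennreal (1 / sqrt (2 * pi)) * ennreal ((cmod (fourier g (R n * y)))\<^sup>2) \<partial>lborel)"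
      by (intro nn_integral_mono mult_right_mono ennreal_leI) (auto simp: std_normal_density_def divide_right_mono)
    also have "\<dots> = ennreal (1 / sqrt (2 * pi)) * (\<integral>\<^sup>+y. ennreal ((cmod (fourier g (R n * y)))\<^sup>2) \<partial>lborel)"
      by (rule nn_integral_cmult) measurable
    finally have "ennreal (sqrt (2 * pi) * R n) * ennreal L \<le> ennreal (sqrt (2 * pi) * R n) *
        (ennreal (1 / sqrt (2 * pi)) * (\<integral>\<^sup>+y. ennreal ((cmod (fourier g (R n * y)))\<^sup>2) \<partial>lborel))"
      by (rule mult_left_mono) simp
    also have "\<dots> = ennreal (R n) * (\<integral>\<^sup>+y. ennreal ((cmod (fourier g (R n * y)))\<^sup>2) \<partial>lborel)"
      using R0[of n] by (simp add: mult.assoc[symmetric] ennreal_mult[symmetric])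
    also have "\<dots> = J"
      using nn_integral_real_affine[of "\<lambda>y. ennreal ((cmod (fourier g y))\<^sup>2)" "R n" 0] R0[of n]
      unfolding J_def by simp
    finally have "ennreal (sqrt (2 * pi) * R n) * ennreal L \<le> J" .
    moreover have "ennreal (sqrt (2 * pi) * R n) * ennreal L = ennreal (sqrt (2 * pi) * R n * L)"
      using R0[of n] by (subst ennreal_mult') auto
    moreover have "sqrt (2 * pi) * R n * L = 2 * pi * c n"
      unfolding L using R0[of n] by simp
    ultimately show ?thesis by simp
  qed
  have "(\<lambda>n. ennreal (2 * pi * c n)) \<longlonglongrightarrow> ennreal (2 * pi * N)"
    using c_lim by (intro tendsto_intros)
  then show ?thesis
    unfolding N_def[symmetric] J_def[symmetric] by (rule LIMSEQ_le_const2) (use c_le in auto)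
qed

section \<open>Heisenberg's inequality in weighted form\<close>

lemma fourier_translation_difference:
  assumes g: "integrable lborel g"
  shows "fourier (\<lambda>t. g (t + h) - g t) \<xi> = (cis (\<xi> * h) - 1) * fourier g \<xi>"
proof -
  have [measurable]: "g \<in> borel_measurable borel" using borel_measurable_integrable[OF g] by simp
  have i1: "integrable lborel (\<lambda>t. g t * cis (-(\<xi> * t)))"
    by (rule Bochner_Integration.integrable_bound[OF g]) (auto simp: norm_mult)
  have gs: "integrable lborel (\<lambda>t. g (t + h))"
    using lborel_integrable_real_affine[OF g, of 1 h] by (simp add: add.commute)
  have i2: "integrable lborel (\<lambda>t. g (t + h) * cis (-(\<xi> * t)))"
    by (rule Bochner_Integration.integrable_bound[OF gs]) (auto simp: norm_mult)
  have "(LINT t|lborel. g (t + h) * cis (-(\<xi> * t))) =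
      (LINT t|lborel. cis (\<xi> * h) * (g (t + h) * cis (-(\<xi> * (t + h)))))"
  proof (intro Bochner_Integration.integral_cong refl)
    fix t
    have "cis (-(\<xi> * t)) = cis (\<xi> * h) * cis (-(\<xi> * (t + h)))"
      by (simp add: cis_mult algebra_simps)
    then show "g (t + h) * cis (-(\<xi> * t)) = cis (\<xi> * h) * (g (t + h) * cis (-(\<xi> * (t + h))))"
      by simp
  qed
  also have "\<dots> = cis (\<xi> * h) * (LINT t|lborel. g (t + h) * cis (-(\<xi> * (t + h))))"
    by simp
  also have "(LINT t|lborel. g (t + h) * cis (-(\<xi> * (t + h)))) = fourier g \<xi>"
    unfolding fourier_def
    using lborel_integral_real_affine[of 1 "\<lambda>t. g t * cis (-(\<xi> * t))" h] by (simp add: add.commute)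
  finally show ?thesis
    unfolding fourier_def by (simp add: left_diff_distrib Bochner_Integration.integral_diff[OF i2 i1])
qed

lemma norm_cis_minus_1_le: "cmod (cis \<theta> - 1) \<le> \<bar>\<theta>\<bar>"
  using iexp_approx1[of \<theta> 0] by (simp add: cis_conv_exp)

text \<open>
  Differences under translation stand in for the derivative of \<open>g\<close>: on the Fourier side they
  become multiplication by \<open>cis (\<xi> * h) - 1\<close>, of modulus at most \<open>\<bar>\<xi> * h\<bar>\<close>. No weak
  derivative has to be constructed.
\<close>

lemma L2_translation_difference_le:
  assumes g: "integrable lborel g" "integrable lborel (\<lambda>t. (cmod (g t))\<^sup>2)"
  shows "integrable lborel (\<lambda>t. (cmod (g (t + h) - g t))\<^sup>2)"
    and "ennreal (2 * pi * (LINT t|lborel. (cmod (g (t + h) - g t))\<^sup>2)) \<le>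
         ennreal (h\<^sup>2) * (\<integral>\<^sup>+\<xi>. ennreal (\<xi>\<^sup>2 * (cmod (fourier g \<xi>))\<^sup>2) \<partial>lborel)"
proof -
  have [measurable]: "g \<in> borel_measurable borel" using borel_measurable_integrable[OF g(1)] by simp
  show D2: "integrable lborel (\<lambda>t. (cmod (g (t + h) - g t))\<^sup>2)"
    using Re_autocorrelation(1)[OF \<open>g \<in> borel_measurable borel\<close> g(2), of "-h"] by simp
  have "integrable lborel (\<lambda>t. g (t + h))"
    using lborel_integrable_real_affine[OF g(1), of 1 h] by (simp add: add.commute)
  then have "integrable lborel (\<lambda>t. g (t + h) - g t)"
    using g(1) by (rule Bochner_Integration.integrable_diff)
  then have "ennreal (2 * pi * (LINT t|lborel. (cmod (g (t + h) - g t))\<^sup>2)) \<le>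
      (\<integral>\<^sup>+\<xi>. ennreal ((cmod (fourier (\<lambda>t. g (t + h) - g t) \<xi>))\<^sup>2) \<partial>lborel)"
    using D2 by (rule plancherel_le)
  also have "\<dots> \<le> (\<integral>\<^sup>+\<xi>. ennreal (h\<^sup>2) * ennreal (\<xi>\<^sup>2 * (cmod (fourier g \<xi>))\<^sup>2) \<partial>lborel)"
  proof (rule nn_integral_mono)
    fix \<xi>
    have "cmod (cis (\<xi> * h) - 1) * cmod (fourier g \<xi>) \<le> \<bar>\<xi> * h\<bar> * cmod (fourier g \<xi>)"
      by (intro mult_right_mono norm_cis_minus_1_le) auto
    then have "(cmod (fourier (\<lambda>t. g (t + h) - g t) \<xi>))\<^sup>2 \<le> (\<bar>\<xi> * h\<bar> * cmod (fourier g \<xi>))\<^sup>2"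
      unfolding fourier_translation_difference[OF g(1)] norm_mult by (intro power_mono) auto
    also have "\<dots> = h\<^sup>2 * (\<xi>\<^sup>2 * (cmod (fourier g \<xi>))\<^sup>2)"
      by (simp add: power_mult_distrib)
    finally show "ennreal ((cmod (fourier (\<lambda>t. g (t + h) - g t) \<xi>))\<^sup>2) \<le>
        ennreal (h\<^sup>2) * ennreal (\<xi>\<^sup>2 * (cmod (fourier g \<xi>))\<^sup>2)"
      by (simp add: ennreal_leI flip: ennreal_mult')
  qed
  also have "\<dots> = ennreal (h\<^sup>2) * (\<integral>\<^sup>+\<xi>. ennreal (\<xi>\<^sup>2 * (cmod (fourier g \<xi>))\<^sup>2) \<partial>lborel)"
    by (rule nn_integral_cmult) measurable
  finally show "ennreal (2 * pi * (LINT t|lborel. (cmod (g (t + h) - g t))\<^sup>2)) \<le>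
         ennreal (h\<^sup>2) * (\<integral>\<^sup>+\<xi>. ennreal (\<xi>\<^sup>2 * (cmod (fourier g \<xi>))\<^sup>2) \<partial>lborel)" .
qed

text \<open>
  The third claim is the discrete form of the integration by parts
  \<open>- \<integral> t \<cdot> (\<bar>g\<bar>\<^sup>2)' = \<integral> \<bar>g\<bar>\<^sup>2\<close>. It holds exactly for every step \<open>h\<close>.
\<close>

lemma weighted_translation_difference:
  fixes g :: "real \<Rightarrow> complex"
  assumes g2: "integrable lborel (\<lambda>t. (cmod (g t))\<^sup>2)"
    and tg: "integrable lborel (\<lambda>t. t\<^sup>2 * (cmod (g t))\<^sup>2)"
    and [measurable]: "g \<in> borel_measurable borel"
  shows "integrable lborel (\<lambda>t. t * (cmod (g t))\<^sup>2)"
    and "integrable lborel (\<lambda>t. t * ((cmod (g t))\<^sup>2 - (cmod (g (t + h)))\<^sup>2))"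
    and "(LINT t|lborel. t * ((cmod (g t))\<^sup>2 - (cmod (g (t + h)))\<^sup>2)) =
         h * (LINT t|lborel. (cmod (g t))\<^sup>2)"
    and "integrable lborel (\<lambda>t. t\<^sup>2 * (cmod (g (t + h)))\<^sup>2)"
    and "(LINT t|lborel. t\<^sup>2 * (cmod (g (t + h)))\<^sup>2) = (LINT t|lborel. t\<^sup>2 * (cmod (g t))\<^sup>2) -
         2 * h * (LINT t|lborel. t * (cmod (g t))\<^sup>2) + h\<^sup>2 * (LINT t|lborel. (cmod (g t))\<^sup>2)"
proof -
  show t1: "integrable lborel (\<lambda>t. t * (cmod (g t))\<^sup>2)"
  proof (rule Bochner_Integration.integrable_bound[OF Bochner_Integration.integrable_add[OF tg g2]])
    have "\<bar>t\<bar> * (cmod (g t))\<^sup>2 \<le> t\<^sup>2 * (cmod (g t))\<^sup>2 + (cmod (g t))\<^sup>2" for t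
    proof -
      have "\<bar>t\<bar> \<le> t\<^sup>2 + 1"
        using sum_squares_bound[of "\<bar>t\<bar>" 1] by simp
      then have "\<bar>t\<bar> * (cmod (g t))\<^sup>2 \<le> (t\<^sup>2 + 1) * (cmod (g t))\<^sup>2"
        by (intro mult_right_mono) auto
      then show ?thesis by (simp add: algebra_simps)
    qed
    then show "AE t in lborel. norm (t * (cmod (g t))\<^sup>2) \<le> norm (t\<^sup>2 * (cmod (g t))\<^sup>2 + (cmod (g t))\<^sup>2)"
      by (simp add: abs_mult)
  qed measurable
  have sh1: "has_bochner_integral lborel (\<lambda>t. t * (cmod (g (t + h)))\<^sup>2)
      ((LINT t|lborel. t * (cmod (g t))\<^sup>2) - h * (LINT t|lborel. (cmod (g t))\<^sup>2))"
  proof -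
    have "has_bochner_integral lborel (\<lambda>t. t * (cmod (g t))\<^sup>2 - h * (cmod (g t))\<^sup>2)
      ((LINT t|lborel. t * (cmod (g t))\<^sup>2) - h * (LINT t|lborel. (cmod (g t))\<^sup>2))"
      using t1 g2 by (simp add: has_bochner_integral_iff)
    then show ?thesis
      using lborel_has_bochner_integral_real_affine_iff[of 1
          "\<lambda>t. t * (cmod (g t))\<^sup>2 - h * (cmod (g t))\<^sup>2" _ h]
      by (simp add: algebra_simps)
  qed
  show "integrable lborel (\<lambda>t. t * ((cmod (g t))\<^sup>2 - (cmod (g (t + h)))\<^sup>2))"
    and "(LINT t|lborel. t * ((cmod (g t))\<^sup>2 - (cmod (g (t + h)))\<^sup>2)) =
         h * (LINT t|lborel. (cmod (g t))\<^sup>2)"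
    using t1 sh1 by (auto simp: has_bochner_integral_iff right_diff_distrib)
  have sh2: "has_bochner_integral lborel (\<lambda>t. t\<^sup>2 * (cmod (g (t + h)))\<^sup>2)
      ((LINT t|lborel. t\<^sup>2 * (cmod (g t))\<^sup>2) -
         2 * h * (LINT t|lborel. t * (cmod (g t))\<^sup>2) + h\<^sup>2 * (LINT t|lborel. (cmod (g t))\<^sup>2))"
  proof -
    have "has_bochner_integral lborel
       (\<lambda>t. t\<^sup>2 * (cmod (g t))\<^sup>2 - 2 * h * (t * (cmod (g t))\<^sup>2) + h\<^sup>2 * (cmod (g t))\<^sup>2)
      ((LINT t|lborel. t\<^sup>2 * (cmod (g t))\<^sup>2) -
         2 * h * (LINT t|lborel. t * (cmod (g t))\<^sup>2) + h\<^sup>2 * (LINT t|lborel. (cmod (g t))\<^sup>2))"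
      using t1 g2 tg by (simp add: has_bochner_integral_iff)
    then show ?thesis
      using lborel_has_bochner_integral_real_affine_iff[of 1
          "\<lambda>t. t\<^sup>2 * (cmod (g t))\<^sup>2 - 2 * h * (t * (cmod (g t))\<^sup>2) + h\<^sup>2 * (cmod (g t))\<^sup>2" _ h]
      by (simp add: algebra_simps power2_eq_square)
  qed
  then show "integrable lborel (\<lambda>t. t\<^sup>2 * (cmod (g (t + h)))\<^sup>2)"
    and "(LINT t|lborel. t\<^sup>2 * (cmod (g (t + h)))\<^sup>2) = (LINT t|lborel. t\<^sup>2 * (cmod (g t))\<^sup>2) -
         2 * h * (LINT t|lborel. t * (cmod (g t))\<^sup>2) + h\<^sup>2 * (LINT t|lborel. (cmod (g t))\<^sup>2)"
    by (auto simp: has_bochner_integral_iff)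
qed

text \<open>
  Factor the difference of squares and apply \<open>p * q \<le> \<mu> * p\<^sup>2 + q\<^sup>2 / (4 * \<mu>)\<close>. Scaling
  \<open>\<mu>\<close> like the inverse step size keeps both terms of the same order.
\<close>

lemma mult_power2_norm_diff_le:
  fixes x y :: complex and t \<mu> :: real
  assumes "\<mu> > 0"
  shows "t * ((cmod x)\<^sup>2 - (cmod y)\<^sup>2) \<le>
         \<mu> * (cmod (y - x))\<^sup>2 + (t\<^sup>2 * (cmod x)\<^sup>2 + t\<^sup>2 * (cmod y)\<^sup>2) / (2 * \<mu>)"
proof -
  define p where "p = cmod (y - x)"
  define q where "q = \<bar>t\<bar> * (cmod x + cmod y)"
  have "t * ((cmod x)\<^sup>2 - (cmod y)\<^sup>2) \<le> \<bar>t * ((cmod x)\<^sup>2 - (cmod y)\<^sup>2)\<bar>" by simp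
  also have "\<dots> = \<bar>cmod x - cmod y\<bar> * q"
    unfolding q_def by (simp add: power2_eq_square square_diff_square_factored abs_mult)
  also have "\<dots> \<le> p * q"
    unfolding p_def q_def
    by (intro mult_right_mono) (auto simp: norm_minus_commute[of y x] norm_triangle_ineq3)
  also have "\<dots> \<le> \<mu> * p\<^sup>2 + q\<^sup>2 / (4 * \<mu>)"
  proof -
    have "\<mu> * p\<^sup>2 + q\<^sup>2 / (4 * \<mu>) - p * q = (2 * \<mu> * p - q)\<^sup>2 / (4 * \<mu>)"
      using assms by (simp add: field_simps power2_eq_square)
    moreover have "(2 * \<mu> * p - q)\<^sup>2 / (4 * \<mu>) \<ge> 0" using assms by simp
    ultimately show ?thesis by linarith
  qed
  also have "q\<^sup>2 / (4 * \<mu>) \<le> (t\<^sup>2 * (cmod x)\<^sup>2 + t\<^sup>2 * (cmod y)\<^sup>2) / (2 * \<mu>)"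
  proof -
    have "(cmod x + cmod y)\<^sup>2 \<le> 2 * ((cmod x)\<^sup>2 + (cmod y)\<^sup>2)"
      using zero_le_power2[of "cmod x - cmod y"] by (simp add: power2_eq_square algebra_simps)
    then have "t\<^sup>2 * (cmod x + cmod y)\<^sup>2 \<le> t\<^sup>2 * (2 * ((cmod x)\<^sup>2 + (cmod y)\<^sup>2))"
      by (rule mult_left_mono) simp
    then have "q\<^sup>2 / (4 * \<mu>) \<le> (t\<^sup>2 * (2 * ((cmod x)\<^sup>2 + (cmod y)\<^sup>2))) / (4 * \<mu>)"
      unfolding q_def power_mult_distrib power2_abs using assms by (intro divide_right_mono) auto
    also have "\<dots> = (t\<^sup>2 * (cmod x)\<^sup>2 + t\<^sup>2 * (cmod y)\<^sup>2) / (2 * \<mu>)"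
      using assms by (simp add: field_simps)
    finally show ?thesis .
  qed
  finally show ?thesis unfolding p_def by simp
qed

text \<open>
  Integrate the previous estimate with \<open>\<mu> = l / h\<close>, divide by \<open>h\<close> and let \<open>h\<close> tend to
  \<open>0\<close>.
\<close>

lemma heisenberg_weighted_real:
  assumes g: "integrable lborel g" "integrable lborel (\<lambda>t. (cmod (g t))\<^sup>2)"
    and tg: "integrable lborel (\<lambda>t. t\<^sup>2 * (cmod (g t))\<^sup>2)"
    and P: "(\<integral>\<^sup>+\<xi>. ennreal (\<xi>\<^sup>2 * (cmod (fourier g \<xi>))\<^sup>2) \<partial>lborel) = ennreal P" "P \<ge> 0"
    and l: "l > 0"
  shows "(LINT t|lborel. (cmod (g t))\<^sup>2) \<le> l / (2 * pi) * P + (LINT t|lborel. t\<^sup>2 * (cmod (g t))\<^sup>2) / l"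
proof -
  have gm: "g \<in> borel_measurable borel" using borel_measurable_integrable[OF g(1)] by simp
  define N where "N = (LINT t|lborel. (cmod (g t))\<^sup>2)"
  define M where "M = (LINT t|lborel. t * (cmod (g t))\<^sup>2)"
  define Q where "Q = (LINT t|lborel. t\<^sup>2 * (cmod (g t))\<^sup>2)"
  note W = weighted_translation_difference[OF g(2) tg gm, folded N_def M_def Q_def]
  have step: "N \<le> l / (2 * pi) * P + (2 * Q - 2 * h * M + h\<^sup>2 * N) / (2 * l)" if h: "h > 0" for h
  proof -
    define D where "D = (LINT t|lborel. (cmod (g (t + h) - g t))\<^sup>2)"
    have D2: "integrable lborel (\<lambda>t. (cmod (g (t + h) - g t))\<^sup>2)"
      by (rule L2_translation_difference_le(1)[OF g])
    have "ennreal (2 * pi * D) \<le> ennreal (h\<^sup>2 * P)"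
      using L2_translation_difference_le(2)[OF g, of h] unfolding P(1) D_def
      by (simp add: ennreal_mult')
    then have "2 * pi * D \<le> h\<^sup>2 * P"
      using P(2) by (subst (asm) ennreal_le_iff) auto
    then have D: "D \<le> h\<^sup>2 * P / (2 * pi)"
      by (simp add: field_simps)
    have "h * N = (LINT t|lborel. t * ((cmod (g t))\<^sup>2 - (cmod (g (t + h)))\<^sup>2))"
      by (rule W(3)[symmetric])
    also have "\<dots> \<le> (LINT t|lborel. (l / h) * (cmod (g (t + h) - g t))\<^sup>2 +
        (t\<^sup>2 * (cmod (g t))\<^sup>2 + t\<^sup>2 * (cmod (g (t + h)))\<^sup>2) / (2 * (l / h)))"
      using h l W(2)[of h] W(4)[of h] D2 tg by (intro integral_mono mult_power2_norm_diff_le) auto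
    also have "\<dots> = (l / h) * D + (2 * Q - 2 * h * M + h\<^sup>2 * N) / (2 * (l / h))"
      using W(4)[of h] D2 tg by (simp add: W(5) D_def Q_def)
    also have "\<dots> \<le> (l / h) * (h\<^sup>2 * P / (2 * pi)) + (2 * Q - 2 * h * M + h\<^sup>2 * N) / (2 * (l / h))"
      using h l D by (intro add_right_mono mult_left_mono) auto
    also have "\<dots> = h * (l / (2 * pi) * P + (2 * Q - 2 * h * M + h\<^sup>2 * N) / (2 * l))"
      using h l by (simp add: field_simps power2_eq_square)
    finally show ?thesis using h by simp
  qed
  have "((\<lambda>h. l / (2 * pi) * P + (2 * Q - 2 * h * M + h\<^sup>2 * N) / (2 * l)) \<longlongrightarrow>
      l / (2 * pi) * P + (2 * Q - 2 * 0 * M + 0\<^sup>2 * N) / (2 * l)) (at_right 0)"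
    using l by (intro tendsto_intros) auto
  moreover have "\<forall>\<^sub>F h in at_right 0. N \<le> l / (2 * pi) * P + (2 * Q - 2 * h * M + h\<^sup>2 * N) / (2 * l)"
    using step by (auto simp: eventually_at_right_less intro: eventually_mono[OF eventually_at_right_less])
  ultimately have "N \<le> l / (2 * pi) * P + (2 * Q - 2 * 0 * M + 0\<^sup>2 * N) / (2 * l)"
    by (rule tendsto_lowerbound) simp
  then show ?thesis using l unfolding N_def Q_def by simp
qed

text \<open>
  Optimising over \<open>l\<close> would give the usual product form. The weighted form is linear in both
  second moments, hence can be integrated over a parameter.
\<close>

lemma heisenberg_weighted:
  assumes g: "integrable lborel g" "integrable lborel (\<lambda>t. (cmod (g t))\<^sup>2)" and l: "l > 0"
  shows "(\<integral>\<^sup>+t. ennreal ((cmod (g t))\<^sup>2) \<partial>lborel) \<le>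
      ennreal (l / (2 * pi)) * (\<integral>\<^sup>+\<xi>. ennreal (\<xi>\<^sup>2 * (cmod (fourier g \<xi>))\<^sup>2) \<partial>lborel) +
      ennreal (1 / l) * (\<integral>\<^sup>+t. ennreal (t\<^sup>2 * (cmod (g t))\<^sup>2) \<partial>lborel)"
proof -
  define P where "P = (\<integral>\<^sup>+\<xi>. ennreal (\<xi>\<^sup>2 * (cmod (fourier g \<xi>))\<^sup>2) \<partial>lborel)"
  define Q where "Q = (\<integral>\<^sup>+t. ennreal (t\<^sup>2 * (cmod (g t))\<^sup>2) \<partial>lborel)"
  have [measurable]: "g \<in> borel_measurable borel" using borel_measurable_integrable[OF g(1)] by simp
  show ?thesis
  proof (cases "P = \<infinity> \<or> Q = \<infinity>")
    case True
    then show ?thesis using l unfolding P_def[symmetric] Q_def[symmetric]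
      by (auto simp: ennreal_mult_eq_top_iff)
  next
    case False
    then obtain p where p: "P = ennreal p" "p \<ge> 0" by (cases P) auto
    have tg: "integrable lborel (\<lambda>t. t\<^sup>2 * (cmod (g t))\<^sup>2)"
      using False unfolding Q_def by (intro integrableI_nonneg) (auto simp: less_top)
    have "(\<integral>\<^sup>+t. ennreal ((cmod (g t))\<^sup>2) \<partial>lborel) = ennreal (LINT t|lborel. (cmod (g t))\<^sup>2)"
      using g(2) by (simp add: nn_integral_eq_integral)
    also have "\<dots> \<le> ennreal (l / (2 * pi) * p + (LINT t|lborel. t\<^sup>2 * (cmod (g t))\<^sup>2) / l)"
      using heisenberg_weighted_real[OF g tg p[unfolded P_def] l] by (rule ennreal_leI)
    also have "\<dots> = ennreal (l / (2 * pi)) * ennreal p + ennreal (1 / l) * ennreal (LINT t|lborel. t\<^sup>2 * (cmod (g t))\<^sup>2)"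
      using l p(2) by (simp add: ennreal_plus ennreal_mult[symmetric])
    also have "ennreal (LINT t|lborel. t\<^sup>2 * (cmod (g t))\<^sup>2) = Q"
      unfolding Q_def using tg by (simp add: nn_integral_eq_integral)
    finally show ?thesis unfolding p(1)[symmetric] P_def Q_def .
  qed
qed

section \<open>The transform as a family of Fourier transforms\<close>

lemma borel_version:
  fixes f :: "real \<Rightarrow> complex"
  assumes "f \<in> borel_measurable lebesgue"
  obtains f' where "f' \<in> borel_measurable borel" "AE t in lborel. f t = f' t"
proof -
  have "(\<lambda>t. Re (f t)) \<in> borel_measurable lebesgue" "(\<lambda>t. Im (f t)) \<in> borel_measurable lebesgue"
    using assms by measurable
  from this[THEN completion_ex_borel_measurable_real]
  obtain r i where ri: "r \<in> borel_measurable lborel" "AE t in lborel. Re (f t) = r t"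
     "i \<in> borel_measurable lborel" "AE t in lborel. Im (f t) = i t" by blast
  show ?thesis
  proof
    show "(\<lambda>t. Complex (r t) (i t)) \<in> borel_measurable borel"
      using ri(1,3) by (simp add: borel_measurable_complex_iff)
    show "AE t in lborel. f t = Complex (r t) (i t)"
      using ri(2,4) by eventually_elim (simp add: complex_eq_iff)
  qed
qed

text \<open>
  The phase \<open>\<theta>\<close> absorbs the part of the kernel that depends on \<open>t\<close> alone.
\<close>

definition windowed :: "(real \<Rightarrow> complex) \<Rightarrow> (real \<Rightarrow> complex) \<Rightarrow> (real \<Rightarrow> real) \<Rightarrow> real \<Rightarrow> real \<Rightarrow> complex" where
  "windowed \<phi> f \<theta> w t = f t * cnj (\<phi> (t - w)) * cis (\<theta> t)"

lemma norm_windowed: "cmod (windowed \<phi> f \<theta> w t) = cmod (f t) * cmod (\<phi> (t - w))"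
  by (simp add: windowed_def norm_mult)

text \<open>
  The phase of the kernel with the terms free of \<open>t\<close> and the coupling \<open>- u * t / b\<close> removed.
\<close>

definition olct_chirp :: "olct_param \<Rightarrow> real \<Rightarrow> real" where
  "olct_chirp A t = (case A of (a, b, c, d, u0, w0) \<Rightarrow> a / (2 * b) * t\<^sup>2 + t * u0 / b)"

lemma AE_lborel_translate:
  fixes P :: "real \<Rightarrow> bool"
  assumes "AE t in lborel. P t"
  shows "AE t in lborel. P (t - w)"
proof -
  obtain N where N: "\<And>t. t \<notin> N \<Longrightarrow> P t" "N \<in> null_sets lborel"
    by (rule AE_E3[OF assms]) auto
  then have [measurable]: "N \<in> sets borel" by auto
  have "AE t in lborel. t \<notin> N" using N(2) by (rule AE_not_in)
  then have "AE t in lborel. - w + 1 * t \<notin> N"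
    by (intro AE_borel_affine) auto
  then show ?thesis
    by eventually_elim (auto intro!: N(1))
qed

lemma olct_kernel_factor:
  assumes "b \<noteq> 0"
  obtains z where "\<And>t. olct_kernel (a, b, c, d, u0, w0) t u =
      z * (cis (olct_chirp (a, b, c, d, u0, w0) t) * cis (-(u / b * t)))"
    "(cmod z)\<^sup>2 = 1 / (2 * pi * \<bar>b\<bar>)"
proof -
  define v where "v = - 1 / b * u * (d * u0 - b * w0) + d / (2 * b) * (u\<^sup>2 + u0\<^sup>2)"
  define z where "z = 1 / csqrt (\<i> * 2 * of_real pi * of_real b) * cis v"
  show ?thesis
  proof
    fix t
    have "a / (2 * b) * t\<^sup>2 - 1 / b * t * (u - u0) - 1 / b * u * (d * u0 - b * w0)
        + d / (2 * b) * (u\<^sup>2 + u0\<^sup>2) = v + (olct_chirp (a, b, c, d, u0, w0) t + -(u / b * t))"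
      using assms unfolding v_def olct_chirp_def by (simp add: field_simps)
    then show "olct_kernel (a, b, c, d, u0, w0) t u =
        z * (cis (olct_chirp (a, b, c, d, u0, w0) t) * cis (-(u / b * t)))"
      unfolding z_def cis_mult mult.assoc olct_kernel.simps by (simp only: cis_conv_exp)
  next
    have "cmod (csqrt (\<i> * 2 * of_real pi * of_real b)) ^ 2 = 2 * pi * \<bar>b\<bar>"
      by (simp add: norm_mult flip: norm_power)
    then show "(cmod z)\<^sup>2 = 1 / (2 * pi * \<bar>b\<bar>)"
      unfolding z_def by (simp add: norm_mult norm_divide power_divide)
  qed
qed

text \<open>
  The kernel is a chirp in \<open>t\<close>, times a Fourier character at frequency \<open>u / b\<close>, times a factor of
  constant modulus. The integral ignores null sets, so Borel representatives \<open>f'\<close> and \<open>\<phi>'\<close> may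
  be used at every point \<open>(u, w)\<close>; the modulus of the transform is then jointly Borel measurable.
\<close>

lemma cmod_wolct_power2:
  fixes f \<phi> f' \<phi>' :: "real \<Rightarrow> complex"
  assumes b: "b \<noteq> 0" and A: "A = (a, b, c, d, u0, w0)"
    and [measurable]: "f' \<in> borel_measurable borel" "\<phi>' \<in> borel_measurable borel"
    and f: "AE t in lborel. f t = f' t" and \<phi>: "AE t in lborel. \<phi> t = \<phi>' t"
    and [measurable]: "f \<in> borel_measurable lebesgue" "\<phi> \<in> borel_measurable lebesgue"
  shows "(cmod (wolct A \<phi> f u w))\<^sup>2 =
     1 / (2 * pi * \<bar>b\<bar>) * (cmod (fourier (windowed \<phi>' f' (olct_chirp A) w) (u / b)))\<^sup>2"
proof -
  obtain z where z: "\<And>t. olct_kernel A t u = z * (cis (olct_chirp A t) * cis (-(u / b * t)))"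
    "(cmod z)\<^sup>2 = 1 / (2 * pi * \<bar>b\<bar>)"
    using olct_kernel_factor[OF b] unfolding A by metis
  have chirp [measurable]: "olct_chirp A \<in> borel_measurable borel"
    unfolding A olct_chirp_def[abs_def] by simp
  define F where "F t = z * (windowed \<phi>' f' (olct_chirp A) w t * cis (-(u / b * t)))" for t
  have F [measurable]: "F \<in> borel_measurable borel"
    unfolding F_def[abs_def] windowed_def by measurable
  have AE: "AE t in lborel. f t * cnj (\<phi> (t - w)) * olct_kernel A t u = F t"
    using f AE_lborel_translate[OF \<phi>, of w]
    by eventually_elim (simp add: F_def windowed_def z(1) mult_ac)
  have "wolct A \<phi> f u w = (LINT t|lebesgue. F t)"
    unfolding wolct_def
  proof (rule integral_cong_AE)
    show "AE t in lebesgue. f t * cnj (\<phi> (t - w)) * olct_kernel A t u = F t"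
      using AE by (rule AE_completion)
    show Fl: "F \<in> borel_measurable lebesgue" using F by (intro measurable_completion) auto
    show "(\<lambda>t. f t * cnj (\<phi> (t - w)) * olct_kernel A t u) \<in> borel_measurable lebesgue"
    proof (rule borel_measurable_AE[OF Fl])
      show "AE t in lebesgue. F t = f t * cnj (\<phi> (t - w)) * olct_kernel A t u"
        using AE_completion[OF AE] by eventually_elim simp
    qed
  qed
  also have "\<dots> = (LINT t|lborel. F t)"
    by (rule integral_completion) simp
  also have "\<dots> = z * fourier (windowed \<phi>' f' (olct_chirp A) w) (u / b)"
    unfolding F_def fourier_def by simp
  finally show ?thesis by (simp add: norm_mult power_mult_distrib z(2))
qed

lemma second_moment_eq_0:
  fixes h :: "real \<Rightarrow> real"
  assumes [measurable]: "h \<in> borel_measurable borel"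
    and "(\<integral>\<^sup>+t. ennreal (t\<^sup>2 * h t) \<partial>lborel) = 0"
  shows "(\<integral>\<^sup>+t. ennreal (h t) \<partial>lborel) = 0"
proof -
  have "AE t in lborel. ennreal (t\<^sup>2 * h t) = 0"
    using assms(2) by (subst (asm) nn_integral_0_iff_AE) auto
  with AE_lborel_singleton[of 0] have "AE t in lborel. ennreal (h t) = 0"
  proof eventually_elim
    case (elim t)
    then show ?case by (auto simp: ennreal_eq_0_iff mult_le_0_iff)
  qed
  then show ?thesis by (subst nn_integral_0_iff_AE) auto
qed

section \<open>Integration over the window position\<close>

context
  fixes f \<phi> :: "real \<Rightarrow> complex" and \<theta> :: "real \<Rightarrow> real"
  assumes f [measurable]: "f \<in> borel_measurable borel"
    and \<phi> [measurable]: "\<phi> \<in> borel_measurable borel"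
    and \<theta> [measurable]: "\<theta> \<in> borel_measurable borel"
    and f2: "integrable lborel (\<lambda>t. (cmod (f t))\<^sup>2)"
    and \<phi>2: "integrable lborel (\<lambda>t. (cmod (\<phi> t))\<^sup>2)"
begin

lemma borel_measurable_windowed [measurable]: "windowed \<phi> f \<theta> w \<in> borel_measurable borel"
  unfolding windowed_def[abs_def] by measurable

lemma borel_measurable_fourier_windowed:
  "(\<lambda>(\<xi>, w). fourier (windowed \<phi> f \<theta> w) \<xi>) \<in> borel_measurable (lborel \<Otimes>\<^sub>M lborel)"
  unfolding windowed_def fourier_def by measurable

lemma integrable_windowed: "integrable lborel (windowed \<phi> f \<theta> w)"
proof (rule Bochner_Integration.integrable_bound)
  have "integrable lborel (\<lambda>t. (cmod (\<phi> (t - w)))\<^sup>2)"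
    using lborel_integrable_real_affine[OF \<phi>2, of 1 "-w"] by (simp add: algebra_simps)
  then show "integrable lborel (\<lambda>t. (cmod (f t))\<^sup>2 + (cmod (\<phi> (t - w)))\<^sup>2)"
    using f2 by (intro Bochner_Integration.integrable_add)
  have "cmod (windowed \<phi> f \<theta> w t) \<le> (cmod (f t))\<^sup>2 + (cmod (\<phi> (t - w)))\<^sup>2" for t
    using sum_squares_bound[of "cmod (f t)" "cmod (\<phi> (t - w))"]
      mult_nonneg_nonneg[OF norm_ge_zero[of "f t"] norm_ge_zero[of "\<phi> (t - w)"]]
    unfolding norm_windowed by linarith
  then show "AE t in lborel. cmod (windowed \<phi> f \<theta> w t) \<le> norm ((cmod (f t))\<^sup>2 + (cmod (\<phi> (t - w)))\<^sup>2)"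
    by simp
qed measurable

text \<open>
  Integrating the window over its position first yields its full squared norm whatever \<open>t\<close> is, so
  weights in \<open>t\<close> pass through to \<open>f\<close>.
\<close>

lemma nn_integral_windowed:
  assumes [measurable]: "k \<in> borel_measurable borel"
  shows "(\<integral>\<^sup>+w. \<integral>\<^sup>+t. k t * ennreal ((cmod (windowed \<phi> f \<theta> w t))\<^sup>2) \<partial>lborel \<partial>lborel) =
    ennreal (LINT t|lborel. (cmod (\<phi> t))\<^sup>2) * (\<integral>\<^sup>+t. k t * ennreal ((cmod (f t))\<^sup>2) \<partial>lborel)"
proof -
  have reflect: "(\<integral>\<^sup>+w. ennreal ((cmod (\<phi> (t - w)))\<^sup>2) \<partial>lborel) = ennreal (LINT t|lborel. (cmod (\<phi> t))\<^sup>2)" for t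
    using nn_integral_real_affine[of "\<lambda>t. ennreal ((cmod (\<phi> t))\<^sup>2)" "-1" t]
      nn_integral_eq_integral[OF \<phi>2] by simp
  have "(\<integral>\<^sup>+w. \<integral>\<^sup>+t. k t * ennreal ((cmod (windowed \<phi> f \<theta> w t))\<^sup>2) \<partial>lborel \<partial>lborel) =
      (\<integral>\<^sup>+t. \<integral>\<^sup>+w. k t * ennreal ((cmod (windowed \<phi> f \<theta> w t))\<^sup>2) \<partial>lborel \<partial>lborel)"
    unfolding windowed_def by (rule lborel_pair.Fubini') measurable
  also have "\<dots> = (\<integral>\<^sup>+t. \<integral>\<^sup>+w. k t * ennreal ((cmod (f t))\<^sup>2) * ennreal ((cmod (\<phi> (t - w)))\<^sup>2) \<partial>lborel \<partial>lborel)"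
    unfolding norm_windowed power_mult_distrib by (simp add: ennreal_mult mult.assoc)
  also have "\<dots> = (\<integral>\<^sup>+t. k t * ennreal ((cmod (f t))\<^sup>2) * ennreal (LINT t|lborel. (cmod (\<phi> t))\<^sup>2) \<partial>lborel)"
    by (simp add: nn_integral_cmult reflect)
  also have "\<dots> = ennreal (LINT t|lborel. (cmod (\<phi> t))\<^sup>2) * (\<integral>\<^sup>+t. k t * ennreal ((cmod (f t))\<^sup>2) \<partial>lborel)"
    by (simp add: nn_integral_cmult mult.commute)
  finally show ?thesis .
qed

lemma nn_integral_windowed_total:
  "(\<integral>\<^sup>+w. \<integral>\<^sup>+t. ennreal ((cmod (windowed \<phi> f \<theta> w t))\<^sup>2) \<partial>lborel \<partial>lborel) =
    ennreal ((LINT t|lborel. (cmod (\<phi> t))\<^sup>2) * (LINT t|lborel. (cmod (f t))\<^sup>2))"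
  using nn_integral_windowed[of "\<lambda>_. 1"] nn_integral_eq_integral[OF f2]
  by (simp add: ennreal_mult)

text \<open>
  Almost every window position gives a function in \<open>L\<^sup>2\<close>, which is what the Fourier estimates
  require; individual positions may fail.
\<close>

lemma AE_integrable_windowed_power2:
  "AE w in lborel. integrable lborel (\<lambda>t. (cmod (windowed \<phi> f \<theta> w t))\<^sup>2)"
proof -
  have "AE w in lborel. (\<integral>\<^sup>+t. ennreal ((cmod (windowed \<phi> f \<theta> w t))\<^sup>2) \<partial>lborel) \<noteq> \<infinity>"
  proof (rule nn_integral_noteq_infinite)
    show "(\<lambda>w. \<integral>\<^sup>+t. ennreal ((cmod (windowed \<phi> f \<theta> w t))\<^sup>2) \<partial>lborel) \<in> borel_measurable lborel"
      unfolding windowed_def by measurable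
  qed (simp add: nn_integral_windowed_total)
  then show ?thesis
    by eventually_elim (rule integrableI_nonneg; auto simp: less_top)
qed

lemma plancherel_windowed_le:
  "ennreal (2 * pi * ((LINT t|lborel. (cmod (\<phi> t))\<^sup>2) * (LINT t|lborel. (cmod (f t))\<^sup>2))) \<le>
   (\<integral>\<^sup>+w. \<integral>\<^sup>+\<xi>. ennreal ((cmod (fourier (windowed \<phi> f \<theta> w) \<xi>))\<^sup>2) \<partial>lborel \<partial>lborel)"
proof -
  have "ennreal (2 * pi * ((LINT t|lborel. (cmod (\<phi> t))\<^sup>2) * (LINT t|lborel. (cmod (f t))\<^sup>2))) =
      ennreal (2 * pi) * (\<integral>\<^sup>+w. \<integral>\<^sup>+t. ennreal ((cmod (windowed \<phi> f \<theta> w t))\<^sup>2) \<partial>lborel \<partial>lborel)"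
    unfolding nn_integral_windowed_total by (rule ennreal_mult') simp
  also have "\<dots> = (\<integral>\<^sup>+w. ennreal (2 * pi) * (\<integral>\<^sup>+t. ennreal ((cmod (windowed \<phi> f \<theta> w t))\<^sup>2) \<partial>lborel) \<partial>lborel)"
    unfolding windowed_def by (subst nn_integral_cmult) measurable
  also have "\<dots> \<le> (\<integral>\<^sup>+w. \<integral>\<^sup>+\<xi>. ennreal ((cmod (fourier (windowed \<phi> f \<theta> w) \<xi>))\<^sup>2) \<partial>lborel \<partial>lborel)"
  proof (rule nn_integral_mono_AE)
    show "AE w in lborel. ennreal (2 * pi) * (\<integral>\<^sup>+t. ennreal ((cmod (windowed \<phi> f \<theta> w t))\<^sup>2) \<partial>lborel) \<le>
       (\<integral>\<^sup>+\<xi>. ennreal ((cmod (fourier (windowed \<phi> f \<theta> w) \<xi>))\<^sup>2) \<partial>lborel)"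
      using AE_integrable_windowed_power2
    proof eventually_elim
      case (elim w)
      show ?case
        using plancherel_le[OF integrable_windowed elim] nn_integral_eq_integral[OF elim]
        by (simp add: ennreal_mult')
    qed
  qed
  finally show ?thesis .
qed

lemma heisenberg_windowed:
  assumes l: "l > 0"
  shows "ennreal ((LINT t|lborel. (cmod (\<phi> t))\<^sup>2) * (LINT t|lborel. (cmod (f t))\<^sup>2)) \<le>
    ennreal (l / (2 * pi)) *
      (\<integral>\<^sup>+w. \<integral>\<^sup>+\<xi>. ennreal (\<xi>\<^sup>2 * (cmod (fourier (windowed \<phi> f \<theta> w) \<xi>))\<^sup>2) \<partial>lborel \<partial>lborel) +
    ennreal (1 / l) *
      (ennreal (LINT t|lborel. (cmod (\<phi> t))\<^sup>2) * (\<integral>\<^sup>+t. ennreal (t\<^sup>2 * (cmod (f t))\<^sup>2) \<partial>lborel))"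
proof -
  have [measurable]: "(\<lambda>w. \<integral>\<^sup>+\<xi>. ennreal (\<xi>\<^sup>2 * (cmod (fourier (windowed \<phi> f \<theta> w) \<xi>))\<^sup>2) \<partial>lborel)
      \<in> borel_measurable borel"
    unfolding windowed_def fourier_def by measurable
  have [measurable]: "(\<lambda>w. \<integral>\<^sup>+t. ennreal (t\<^sup>2 * (cmod (windowed \<phi> f \<theta> w t))\<^sup>2) \<partial>lborel)
      \<in> borel_measurable borel"
    unfolding windowed_def by measurable
  have "ennreal ((LINT t|lborel. (cmod (\<phi> t))\<^sup>2) * (LINT t|lborel. (cmod (f t))\<^sup>2)) =
      (\<integral>\<^sup>+w. \<integral>\<^sup>+t. ennreal ((cmod (windowed \<phi> f \<theta> w t))\<^sup>2) \<partial>lborel \<partial>lborel)"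
    by (rule nn_integral_windowed_total[symmetric])
  also have "\<dots> \<le> (\<integral>\<^sup>+w. ennreal (l / (2 * pi)) *
       (\<integral>\<^sup>+\<xi>. ennreal (\<xi>\<^sup>2 * (cmod (fourier (windowed \<phi> f \<theta> w) \<xi>))\<^sup>2) \<partial>lborel) +
       ennreal (1 / l) * (\<integral>\<^sup>+t. ennreal (t\<^sup>2 * (cmod (windowed \<phi> f \<theta> w t))\<^sup>2) \<partial>lborel) \<partial>lborel)"
    using AE_integrable_windowed_power2
    by (intro nn_integral_mono_AE) (auto elim!: eventually_mono intro!: heisenberg_weighted integrable_windowed l)
  also have "\<dots> = ennreal (l / (2 * pi)) *
       (\<integral>\<^sup>+w. \<integral>\<^sup>+\<xi>. ennreal (\<xi>\<^sup>2 * (cmod (fourier (windowed \<phi> f \<theta> w) \<xi>))\<^sup>2) \<partial>lborel \<partial>lborel) +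
       ennreal (1 / l) * (\<integral>\<^sup>+w. \<integral>\<^sup>+t. ennreal (t\<^sup>2 * (cmod (windowed \<phi> f \<theta> w t))\<^sup>2) \<partial>lborel \<partial>lborel)"
    by (simp add: nn_integral_add nn_integral_cmult)
  also have "(\<integral>\<^sup>+w. \<integral>\<^sup>+t. ennreal (t\<^sup>2 * (cmod (windowed \<phi> f \<theta> w t))\<^sup>2) \<partial>lborel \<partial>lborel) =
      ennreal (LINT t|lborel. (cmod (\<phi> t))\<^sup>2) * (\<integral>\<^sup>+t. ennreal (t\<^sup>2 * (cmod (f t))\<^sup>2) \<partial>lborel)"
    using nn_integral_windowed[of "\<lambda>t. ennreal (t\<^sup>2)"] by (simp add: ennreal_mult'')
  finally show ?thesis .
qed

text \<open>
  Excludes the case \<open>0 * \<infinity>\<close> in the product of moments, on which the weighted inequality is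
  silent: a transform concentrated at frequency \<open>0\<close> vanishes almost everywhere, and then
  \<open>plancherel_windowed_le\<close> applies.
\<close>

lemma second_moment_fourier_windowed_eq_0:
  assumes "(\<integral>\<^sup>+w. \<integral>\<^sup>+\<xi>. ennreal (\<xi>\<^sup>2 * (cmod (fourier (windowed \<phi> f \<theta> w) \<xi>))\<^sup>2) \<partial>lborel \<partial>lborel) = 0"
  shows "(LINT t|lborel. (cmod (\<phi> t))\<^sup>2) * (LINT t|lborel. (cmod (f t))\<^sup>2) = 0"
proof -
  have "(\<lambda>w. \<integral>\<^sup>+\<xi>. ennreal (\<xi>\<^sup>2 * (cmod (fourier (windowed \<phi> f \<theta> w) \<xi>))\<^sup>2) \<partial>lborel)
      \<in> borel_measurable lborel"
    unfolding windowed_def fourier_def by measurable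
  then have "AE w in lborel. (\<integral>\<^sup>+\<xi>. ennreal (\<xi>\<^sup>2 * (cmod (fourier (windowed \<phi> f \<theta> w) \<xi>))\<^sup>2) \<partial>lborel) = 0"
    using assms by (subst (asm) nn_integral_0_iff_AE) auto
  then have "AE w in lborel. (\<integral>\<^sup>+\<xi>. ennreal ((cmod (fourier (windowed \<phi> f \<theta> w) \<xi>))\<^sup>2) \<partial>lborel) = 0"
    by eventually_elim (rule second_moment_eq_0; measurable)
  then have "(\<integral>\<^sup>+w. \<integral>\<^sup>+\<xi>. ennreal ((cmod (fourier (windowed \<phi> f \<theta> w) \<xi>))\<^sup>2) \<partial>lborel \<partial>lborel) =
      (\<integral>\<^sup>+(w::real). 0 \<partial>lborel)"
    by (rule nn_integral_cong_AE)
  moreover define x where "x = (LINT t|lborel. (cmod (\<phi> t))\<^sup>2) * (LINT t|lborel. (cmod (f t))\<^sup>2)"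
  ultimately have "ennreal (2 * pi * x) \<le> 0"
    using plancherel_windowed_le by simp
  then have "2 * pi * x \<le> 0"
    by (simp only: ennreal_le_iff2 ennreal_0[symmetric]) auto
  moreover have "x \<ge> 0" unfolding x_def by simp
  ultimately have "x = 0"
    using pi_gt_zero by (auto simp: mult_le_0_iff)
  then show ?thesis unfolding x_def .
qed

end

text \<open>
  Change of variables \<open>u = b * \<xi>\<close>. Nonnegative integrals do not see the completion of a measure,
  which brings the iterated Borel integrals within reach of Tonelli's theorem.
\<close>

lemma nn_integral_wolct_eq:
  fixes V :: "real \<Rightarrow> real \<Rightarrow> complex" and G :: "real \<Rightarrow> real \<Rightarrow> complex" and k :: "real \<Rightarrow> real"
  assumes b: "b > 0"
    and V: "\<And>u w. (cmod (V u w))\<^sup>2 = 1 / (2 * pi * b) * (cmod (G w (u / b)))\<^sup>2"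
    and G [measurable]: "(\<lambda>(\<xi>, w). G w \<xi>) \<in> borel_measurable (lborel \<Otimes>\<^sub>M lborel)"
    and k [measurable]: "k \<in> borel_measurable borel" and k0: "\<And>u. k u \<ge> 0"
  shows "(\<integral>\<^sup>+(u, w). ennreal (k u * (cmod (V u w))\<^sup>2) \<partial>lebesgue) =
    (\<integral>\<^sup>+w. \<integral>\<^sup>+\<xi>. ennreal (k (b * \<xi>) / (2 * pi) * (cmod (G w \<xi>))\<^sup>2) \<partial>lborel \<partial>lborel)"
proof -
  have m: "(\<lambda>p. ennreal (k (fst p) * (1 / (2 * pi * b) * (cmod (G (snd p) (fst p / b)))\<^sup>2)))
      \<in> borel_measurable (lborel \<Otimes>\<^sub>M lborel)"
  proof -
    have "(\<lambda>p. (\<lambda>(\<xi>, w). G w \<xi>) (fst p / b, snd p)) \<in> borel_measurable (lborel \<Otimes>\<^sub>M lborel)"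
      by (rule measurable_compose[OF _ G]) measurable
    then have [measurable]: "(\<lambda>p. G (snd p) (fst p / b)) \<in> borel_measurable (lborel \<Otimes>\<^sub>M lborel)"
      by simp
    show ?thesis by measurable
  qed
  have Gw [measurable]: "G w \<in> borel_measurable borel" for w
    using measurable_compose[OF measurable_Pair2' G, of w] by simp
  have "(\<integral>\<^sup>+(u, w). ennreal (k u * (cmod (V u w))\<^sup>2) \<partial>lebesgue) =
      (\<integral>\<^sup>+p. ennreal (k (fst p) * (1 / (2 * pi * b) * (cmod (G (snd p) (fst p / b)))\<^sup>2)) \<partial>lborel)"
    unfolding nn_integral_completion V by (simp add: case_prod_beta')
  also have "\<dots> = (\<integral>\<^sup>+w. \<integral>\<^sup>+u. ennreal (k u * (1 / (2 * pi * b) * (cmod (G w (u / b)))\<^sup>2)) \<partial>lborel \<partial>lborel)"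
    unfolding lborel_prod[symmetric] by (subst lborel_pair.nn_integral_snd[symmetric, OF m]) simp
  also have "\<dots> = (\<integral>\<^sup>+w. \<integral>\<^sup>+\<xi>. ennreal (k (b * \<xi>) / (2 * pi) * (cmod (G w \<xi>))\<^sup>2) \<partial>lborel \<partial>lborel)"
  proof (rule nn_integral_cong)
    fix w
    have "(\<integral>\<^sup>+u. ennreal (k u * (1 / (2 * pi * b) * (cmod (G w (u / b)))\<^sup>2)) \<partial>lborel) =
        ennreal b * (\<integral>\<^sup>+\<xi>. ennreal (k (b * \<xi>) * (1 / (2 * pi * b) * (cmod (G w \<xi>))\<^sup>2)) \<partial>lborel)"
      using nn_integral_real_affine[of "\<lambda>u. ennreal (k u * (1 / (2 * pi * b) * (cmod (G w (u / b)))\<^sup>2))" b 0] b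
      by simp
    also have "\<dots> = (\<integral>\<^sup>+\<xi>. ennreal b * ennreal (k (b * \<xi>) * (1 / (2 * pi * b) * (cmod (G w \<xi>))\<^sup>2)) \<partial>lborel)"
      by (rule nn_integral_cmult[symmetric]) measurable
    also have "\<dots> = (\<integral>\<^sup>+\<xi>. ennreal (k (b * \<xi>) / (2 * pi) * (cmod (G w \<xi>))\<^sup>2) \<partial>lborel)"
      using b k0 by (intro nn_integral_cong) (simp add: ennreal_mult'[symmetric] field_simps)
    finally show "(\<integral>\<^sup>+u. ennreal (k u * (1 / (2 * pi * b) * (cmod (G w (u / b)))\<^sup>2)) \<partial>lborel) =
        (\<integral>\<^sup>+\<xi>. ennreal (k (b * \<xi>) / (2 * pi) * (cmod (G w \<xi>))\<^sup>2) \<partial>lborel)" .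
  qed
  finally show ?thesis .
qed

section \<open>The uncertainty inequality\<close>

text \<open>
  Optimises the weighted inequality over \<open>l\<close>. If one moment is infinite, the other must be shown to
  be nonzero, because the product of \<open>0\<close> and \<open>\<infinity>\<close> is \<open>0\<close>; the last two hypotheses provide this.
\<close>

lemma le_ennreal_sqrt_mult:
  fixes U T :: ennreal and F H b :: real
  assumes F: "F \<ge> 0" and H: "H \<ge> 0" and b: "b > 0"
    and bound: "\<And>l. l > 0 \<Longrightarrow> ennreal (H\<^sup>2 * F\<^sup>2) \<le> ennreal (l / b\<^sup>2) * U + ennreal (1 / l) * (ennreal (H\<^sup>2) * T)"
    and U0: "U = 0 \<Longrightarrow> H * F = 0" and T0: "T = 0 \<Longrightarrow> F = 0"
  shows "ereal (b / 2 * F\<^sup>2 * H) \<le> enn2ereal (ennreal_sqrt U * ennreal_sqrt T)"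
proof (cases "H * F = 0")
  case True
  then have "b / 2 * F\<^sup>2 * H = 0" by auto
  then show ?thesis by (simp only: zero_ereal_def[symmetric] enn2ereal_nonneg)
next
  case False
  then have FH: "F > 0" "H > 0" using F H by auto
  have UT: "U \<noteq> 0" "T \<noteq> 0" using U0 T0 False by auto
  have pos: "ennreal_sqrt x \<noteq> 0" if "x \<noteq> 0" for x
    using that by (cases x) (auto simp: ennreal_sqrt_def)
  show ?thesis
  proof (cases "U = \<infinity> \<or> T = \<infinity>")
    case True
    then have "ennreal_sqrt U * ennreal_sqrt T = \<infinity>"
      using pos[OF UT(1)] pos[OF UT(2)] by (auto simp: ennreal_sqrt_def ennreal_mult_eq_top_iff)
    then show ?thesis by simp
  next
    case False
    then obtain p q where p: "U = ennreal p" "p \<ge> 0" and q: "T = ennreal q" "q \<ge> 0"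
      by (cases U; cases T) auto
    have pq: "p > 0" "q > 0" using UT p q by (auto simp: less_le)
    \<comment> \<open>This choice makes the two terms of the bound equal, which minimises their sum.\<close>
    define l where "l = b * H * sqrt q / sqrt p"
    have l: "l > 0" using pq b FH unfolding l_def by simp
    have "ennreal (H\<^sup>2 * F\<^sup>2) \<le> ennreal (l / b\<^sup>2 * p + 1 / l * (H\<^sup>2 * q))"
      using bound[OF l] l pq unfolding p(1) q(1) by (simp add: ennreal_mult[symmetric] ennreal_plus[symmetric] del: ennreal_plus)
    then have "H\<^sup>2 * F\<^sup>2 \<le> l / b\<^sup>2 * p + 1 / l * (H\<^sup>2 * q)"
      using l pq by (subst (asm) ennreal_le_iff) auto
    also have "l / b\<^sup>2 * p = H / b * (sqrt q * sqrt p)"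
    proof -
      have "p = sqrt p * sqrt p" using pq by simp
      then have "l / b\<^sup>2 * p = l / b\<^sup>2 * (sqrt p * sqrt p)" by simp
      also have "\<dots> = H / b * (sqrt q * sqrt p)"
        unfolding l_def using pq b by (simp add: field_simps power2_eq_square)
      finally show ?thesis .
    qed
    also have "1 / l * (H\<^sup>2 * q) = H / b * (sqrt q * sqrt p)"
    proof -
      have "q = sqrt q * sqrt q" using pq by simp
      then have "1 / l * (H\<^sup>2 * q) = 1 / l * (H\<^sup>2 * (sqrt q * sqrt q))" by simp
      also have "\<dots> = H / b * (sqrt q * sqrt p)"
        unfolding l_def using pq b FH by (simp add: field_simps power2_eq_square)
      finally show ?thesis .
    qed
    finally have "H * (H * F\<^sup>2) \<le> H * (2 / b * (sqrt q * sqrt p))"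
      by (simp add: power2_eq_square mult_ac)
    then have "H * F\<^sup>2 \<le> 2 / b * (sqrt q * sqrt p)"
      using FH(2) by (rule mult_left_le_imp_le)
    then have "b / 2 * F\<^sup>2 * H \<le> sqrt p * sqrt q" using b by (simp add: field_simps)
    moreover have "ennreal_sqrt U * ennreal_sqrt T = ennreal (sqrt p * sqrt q)"
      unfolding p(1) q(1) ennreal_sqrt_def using p(2) q(2) by (simp add: ennreal_mult)
    ultimately show ?thesis using p(2) q(2) by (simp add: enn2ereal_ennreal)
  qed
qed

lemma square_integrable_borel_version:
  fixes f :: "real \<Rightarrow> complex"
  assumes f: "square_integrable f" and [measurable]: "f' \<in> borel_measurable borel"
    and AE: "AE t in lborel. f t = f' t"
  shows "integrable lborel (\<lambda>t. (cmod (f' t))\<^sup>2)"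
    and "(LINT t|lborel. (cmod (f' t))\<^sup>2) = (L2_norm f)\<^sup>2"
proof -
  have m: "(\<lambda>t. (cmod (f t))\<^sup>2) \<in> borel_measurable lebesgue"
    using f unfolding square_integrable_def by auto
  have m': "(\<lambda>t. (cmod (f' t))\<^sup>2) \<in> borel_measurable lborel" by measurable
  then have m'': "(\<lambda>t. (cmod (f' t))\<^sup>2) \<in> borel_measurable lebesgue"
    by (rule measurable_completion)
  have AE': "AE t in lebesgue. (cmod (f t))\<^sup>2 = (cmod (f' t))\<^sup>2"
    using AE_completion[OF AE] by eventually_elim simp
  have "integrable lebesgue (\<lambda>t. (cmod (f' t))\<^sup>2)"
    using f integrable_cong_AE[OF m m'' AE'] unfolding square_integrable_def by simp
  then show "integrable lborel (\<lambda>t. (cmod (f' t))\<^sup>2)"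
    unfolding integrable_completion[OF m'] .
  have "(L2_norm f)\<^sup>2 = (LINT t|lebesgue. (cmod (f t))\<^sup>2)"
    unfolding L2_norm_def by simp
  also have "\<dots> = (LINT t|lebesgue. (cmod (f' t))\<^sup>2)"
    by (rule integral_cong_AE[OF m m'' AE'])
  also have "\<dots> = (LINT t|lborel. (cmod (f' t))\<^sup>2)"
    by (rule integral_completion[OF m'])
  finally show "(LINT t|lborel. (cmod (f' t))\<^sup>2) = (L2_norm f)\<^sup>2" by simp
qed

theorem theorem1:
  fixes a b c d u0 w0 :: real and A :: olct_param
    and f \<phi> :: "real \<Rightarrow> complex"
  assumes "A = (a, b, c, d, u0, w0)"
    and "a * d - b * c = 1" and "b \<noteq> 0"
    and "square_integrable \<phi>" and "\<not> (AE t in lebesgue. \<phi> t = 0)"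
    and "square_integrable f"
    and "square_integrable (\<lambda>(u, w). wolct A \<phi> f u w)"
  shows "enn2ereal
           (ennreal_sqrt (\<integral>\<^sup>+ (u, w). ennreal (u\<^sup>2 * (cmod (wolct A \<phi> f u w))\<^sup>2) \<partial>lebesgue) *
            ennreal_sqrt (\<integral>\<^sup>+ t. ennreal (t\<^sup>2 * (cmod (f t))\<^sup>2) \<partial>lebesgue))
         \<ge> ereal (b / 2 * (L2_norm f)\<^sup>2 * L2_norm \<phi>)"
proof (cases "b > 0")
  \<comment> \<open>For negative \<open>b\<close> the lower bound is not positive.\<close>
  case False
  have nonneg: "L2_norm \<phi> \<ge> 0" by (simp add: L2_norm_def)
  have "b / 2 * (L2_norm f)\<^sup>2 * L2_norm \<phi> \<le> 0"
    using False nonneg by (intro mult_nonpos_nonneg) auto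
  then have "ereal (b / 2 * (L2_norm f)\<^sup>2 * L2_norm \<phi>) \<le> 0" by simp
  then show ?thesis using enn2ereal_nonneg by (rule order_trans)
next
  case True
  have fm: "f \<in> borel_measurable lebesgue" and \<phi>m: "\<phi> \<in> borel_measurable lebesgue"
    using assms(4,6) unfolding square_integrable_def by auto
  obtain f' where f': "f' \<in> borel_measurable borel" "AE t in lborel. f t = f' t"
    using borel_version[OF fm] by blast
  obtain \<phi>' where \<phi>': "\<phi>' \<in> borel_measurable borel" "AE t in lborel. \<phi> t = \<phi>' t"
    using borel_version[OF \<phi>m] by blast
  note f2 = square_integrable_borel_version[OF assms(6) f']
  note \<phi>2 = square_integrable_borel_version[OF assms(4) \<phi>']
  have chirp: "olct_chirp A \<in> borel_measurable borel"
    unfolding assms(1) olct_chirp_def[abs_def] by simp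
  note windowed = f'(1) \<phi>'(1) chirp f2(1) \<phi>2(1)
  define G where "G w = fourier (windowed \<phi>' f' (olct_chirp A) w)" for w
  define J where "J = (\<integral>\<^sup>+w. \<integral>\<^sup>+\<xi>. ennreal (\<xi>\<^sup>2 * (cmod (G w \<xi>))\<^sup>2) \<partial>lborel \<partial>lborel)"
  define U where "U = (\<integral>\<^sup>+(u, w). ennreal (u\<^sup>2 * (cmod (wolct A \<phi> f u w))\<^sup>2) \<partial>lebesgue)"
  define T where "T = (\<integral>\<^sup>+t. ennreal (t\<^sup>2 * (cmod (f t))\<^sup>2) \<partial>lebesgue)"
  have V: "(cmod (wolct A \<phi> f u w))\<^sup>2 = 1 / (2 * pi * b) * (cmod (G w (u / b)))\<^sup>2" for u w
    using cmod_wolct_power2[OF assms(3,1) f'(1) \<phi>'(1) f'(2) \<phi>'(2) fm \<phi>m] True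
    unfolding G_def by simp
  have Gm: "(\<lambda>(\<xi>, w). G w \<xi>) \<in> borel_measurable (lborel \<Otimes>\<^sub>M lborel)"
    unfolding G_def by (rule borel_measurable_fourier_windowed[OF windowed])
  have U: "U = ennreal (b\<^sup>2 / (2 * pi)) * J"
  proof -
    have [measurable]: "(\<lambda>w. \<integral>\<^sup>+\<xi>. ennreal (\<xi>\<^sup>2 * (cmod (G w \<xi>))\<^sup>2) \<partial>lborel) \<in> borel_measurable lborel"
      using f'(1) \<phi>'(1) chirp unfolding G_def windowed_def fourier_def by measurable
    have [measurable]: "G w \<in> borel_measurable borel" for w
      unfolding G_def by (intro borel_measurable_fourier borel_measurable_windowed windowed)
    have "U = (\<integral>\<^sup>+w. \<integral>\<^sup>+\<xi>. ennreal ((b * \<xi>)\<^sup>2 / (2 * pi) * (cmod (G w \<xi>))\<^sup>2) \<partial>lborel \<partial>lborel)"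
      unfolding U_def by (rule nn_integral_wolct_eq[OF True V Gm]) auto
    also have "\<dots> = (\<integral>\<^sup>+w. \<integral>\<^sup>+\<xi>. ennreal (b\<^sup>2 / (2 * pi)) * ennreal (\<xi>\<^sup>2 * (cmod (G w \<xi>))\<^sup>2) \<partial>lborel \<partial>lborel)"
      by (simp add: ennreal_mult'[symmetric] power_mult_distrib mult_ac)
    also have "\<dots> = ennreal (b\<^sup>2 / (2 * pi)) * J"
      unfolding J_def by (simp add: nn_integral_cmult)
    finally show ?thesis .
  qed
  have T: "T = (\<integral>\<^sup>+t. ennreal (t\<^sup>2 * (cmod (f' t))\<^sup>2) \<partial>lborel)"
    unfolding T_def nn_integral_completion using f'(2) by (intro nn_integral_cong_AE) auto
  have "ereal (b / 2 * (L2_norm f)\<^sup>2 * L2_norm \<phi>) \<le> enn2ereal (ennreal_sqrt U * ennreal_sqrt T)"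
  proof (rule le_ennreal_sqrt_mult[OF _ _ True])
    fix l :: real assume l: "l > 0"
    have "ennreal (l / b\<^sup>2) * U = ennreal (l / (2 * pi)) * J"
      unfolding U mult.assoc[symmetric] using l True by (simp add: ennreal_mult'[symmetric])
    then show "ennreal ((L2_norm \<phi>)\<^sup>2 * (L2_norm f)\<^sup>2) \<le>
        ennreal (l / b\<^sup>2) * U + ennreal (1 / l) * (ennreal ((L2_norm \<phi>)\<^sup>2) * T)"
      using heisenberg_windowed[OF windowed l] unfolding T J_def G_def f2(2) \<phi>2(2) by simp
  next
    assume "U = 0"
    moreover have "b\<^sup>2 / (2 * pi) > 0" using True by simp
    ultimately have "J = 0" unfolding U by (auto simp: ennreal_eq_0_iff)
    then show "L2_norm \<phi> * L2_norm f = 0"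
      using second_moment_fourier_windowed_eq_0[OF windowed] unfolding J_def G_def f2(2) \<phi>2(2) by simp
  next
    assume "T = 0"
    then have "(\<integral>\<^sup>+t. ennreal ((cmod (f' t))\<^sup>2) \<partial>lborel) = 0"
      unfolding T by (rule second_moment_eq_0[rotated]) (use f'(1) in measurable)
    then have "ennreal ((L2_norm f)\<^sup>2) = 0"
      using nn_integral_eq_integral[OF f2(1)] unfolding f2(2) by simp
    then show "L2_norm f = 0" by (simp add: ennreal_eq_0_iff)
  qed (auto simp: L2_norm_def)
  then show ?thesis unfolding U_def T_def .
qed

end
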